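(* Fix costs $c_{\mathrm{rew}},c_{\mathrm{ver}}>0$, and let $\mathcal A_{\mathrm{ADAP}}$ be the shellwise policy described in the context. For every active search instance $(\mathcal D,h^\star)$ with $\Pr(V=1)>0$ and $h^\star$ non-decreasing on $\mathbb R$, the policy $\mathcal A_{\mathrm{ADAP}}$ is sound and satisfies \[ \mathbb E\big[J(\mathcal A_{\mathrm{ADAP}};h^\star,\mathcal D)\big]\le 400\,J^\star(h^\star,\mathcal D). \]
   Context: An active search instance is a pair $(\mathcal D,h^\star)$, where $\mathcal D$ is a probability distribution on $\mathbb R$ and $h^\star:\mathbb R\to[0,1]$ is measurable. Each generated candidate carries a score $R\sim\mathcal D$ and a hidden label $V\in\{0,1\}$ with $\Pr(V=1\mid R=r)=h^\star(r)$; candidates are i.i.d. An active search policy maintains a pool of generated but unverified candidates; at each step, as a function of the history (observed scores, previous verification choices, observed labels, internal randomness), it either generates a fresh candidate (cost $c_{\mathrm{rew}}$, score observed, candidate added to the pool) or verifies a pool candidate (cost $c_{\mathrm{ver}}$, label observed, candidate removed from the pool; on label $1$ it stops and outputs the candidate). Sound means it stops only on observing label $1$. The cost is $J=c_{\mathrm{rew}}N_{\mathrm{rew}}+c_{\mathrm{ver}}N_{\mathrm{ver}}$ ($N_{\mathrm{rew}},N_{\mathrm{ver}}$ the numbers of generations and verifications), with $J=+\infty$ if no positive label is ever observed. $J^\star(h^\star,\mathcal D)$ is the infimum of $\mathbb E[J]$ over all such policies that additionally know $(\mathcal D,h^\star)$. The policy $\mathcal A_{\mathrm{ADAP}}$ (which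 does not know $(\mathcal D,h^\star)$): let $c_{\min}=\min\{c_{\mathrm{rew}},c_{\mathrm{ver}}\}$ and start with an empty pool $P$. For $s=0,1,2,\dots$: let $S_s=\{(a,b)\in\mathbb Z_{\ge0}^2: a\le b,\ 2^sc_{\min}\le c_{\mathrm{rew}}2^b+c_{\mathrm{ver}}2^{b-a}<2^{s+1}c_{\min}\}$; if $S_s=\emptyset$ go to the next $s$. Otherwise let $b_s^\star=\max\{b:(a,b)\in S_s\}$, $j_s^\star=\max\{b-a:(a,b)\in S_s\}$, $m_s=\lceil 2^{b_s^\star+1}\rceil$, $k_s=\lceil 6\cdot2^{j_s^\star}\rceil$. Generate $m_s$ fresh candidates and add them (with their scores) to $P$. Order the elements of $P$ by non-increasing score, and for $j=1,\dots,\min\{k_s,|P|\}$ verify the $j$-th element of this ordering, remove it from $P$, and if its label is $1$, return it. *)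

theory Defs
  imports "HOL-Probability.Probability"
begin

text \<open>Candidates are indexed by generation order: the i-th generated candidate is
  the i-th coordinate of an i.i.d. sequence of (score, label) pairs.\<close>

datatype event = Gen real | Ver nat bool
datatype action = Generate | Verify nat

text \<open>A (randomised) policy: internal randomness is an i.i.d. sequence of fair coins.\<close>
type_synonym policy = "(nat \<Rightarrow> bool) \<Rightarrow> event list \<Rightarrow> action"

fun gen_scores :: "event list \<Rightarrow> real list" where
  "gen_scores [] = []"
| "gen_scores (Gen r # h) = r # gen_scores h"
| "gen_scores (Ver _ _ # h) = gen_scores h"

fun verified :: "event list \<Rightarrow> nat set" where
  "verified [] = {}"
| "verified (Gen _ # h) = verified h"
| "verified (Ver i _ # h) = insert i (verified h)"

definition pool :: "event list \<Rightarrow> nat set" where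
  "pool h = {i. i < length (gen_scores h)} - verified h"

definition valid_action :: "event list \<Rightarrow> action \<Rightarrow> bool" where
  "valid_action h a = (case a of Generate \<Rightarrow> True | Verify i \<Rightarrow> i \<in> pool h)"

definition next_event :: "(nat \<Rightarrow> real \<times> bool) \<Rightarrow> event list \<Rightarrow> action \<Rightarrow> event" where
  "next_event \<omega> h a = (case a of
      Generate \<Rightarrow> Gen (fst (\<omega> (length (gen_scores h))))
    | Verify i \<Rightarrow> Ver i (snd (\<omega> i)))"

primrec run :: "policy \<Rightarrow> (nat \<Rightarrow> bool) \<Rightarrow> (nat \<Rightarrow> real \<times> bool) \<Rightarrow> nat \<Rightarrow> event list" where
  "run pol u \<omega> 0 = []"
| "run pol u \<omega> (Suc t) = run pol u \<omega> t @ [next_event \<omega> (run pol u \<omega> t) (pol u (run pol u \<omega> t))]"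

definition act :: "policy \<Rightarrow> (nat \<Rightarrow> bool) \<Rightarrow> (nat \<Rightarrow> real \<times> bool) \<Rightarrow> nat \<Rightarrow> action" where
  "act pol u \<omega> t = pol u (run pol u \<omega> t)"

definition success :: "policy \<Rightarrow> (nat \<Rightarrow> bool) \<Rightarrow> (nat \<Rightarrow> real \<times> bool) \<Rightarrow> nat \<Rightarrow> bool" where
  "success pol u \<omega> t = (case act pol u \<omega> t of Generate \<Rightarrow> False | Verify i \<Rightarrow> snd (\<omega> i))"

definition step_cost :: "real \<Rightarrow> real \<Rightarrow> action \<Rightarrow> real" where
  "step_cost cr cv a = (case a of Generate \<Rightarrow> cr | Verify _ \<Rightarrow> cv)"

definition cost :: "real \<Rightarrow> real \<Rightarrow> policy \<Rightarrow> (nat \<Rightarrow> bool) \<Rightarrow> (nat \<Rightarrow> real \<times> bool) \<Rightarrow> ennreal" where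
  "cost cr cv pol u \<omega> =
     (if \<exists>t. success pol u \<omega> t then
        (let T = (LEAST t. success pol u \<omega> t) in
          if \<forall>s\<le>T. valid_action (run pol u \<omega> s) (act pol u \<omega> s)
          then ennreal (\<Sum>s\<le>T. step_cost cr cv (act pol u \<omega> s))
          else \<infinity>)
      else \<infinity>)"

definition legal_policy :: "policy \<Rightarrow> bool" where
  "legal_policy pol = (\<forall>u \<omega> t. (\<forall>s<t. \<not> success pol u \<omega> s) \<longrightarrow>
        valid_action (run pol u \<omega> t) (act pol u \<omega> t))"

text \<open>Joint law of (R,V): R \<sim> D and Pr(V=1 | R=r) = h r.\<close>
definition cand_measure :: "real measure \<Rightarrow> (real \<Rightarrow> real) \<Rightarrow> (real \<times> bool) measure" where
  "cand_measure D h = density (D \<Otimes>\<^sub>M count_space UNIV)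
      (\<lambda>(r, b). ennreal (if b then h r else 1 - h r))"

definition cands_M :: "real measure \<Rightarrow> (real \<Rightarrow> real) \<Rightarrow> (nat \<Rightarrow> real \<times> bool) measure" where
  "cands_M D h = PiM UNIV (\<lambda>_. cand_measure D h)"

definition coins_M :: "(nat \<Rightarrow> bool) measure" where
  "coins_M = PiM UNIV (\<lambda>_. measure_pmf (bernoulli_pmf (1/2)))"

definition joint_M :: "real measure \<Rightarrow> (real \<Rightarrow> real) \<Rightarrow> ((nat \<Rightarrow> bool) \<times> (nat \<Rightarrow> real \<times> bool)) measure" where
  "joint_M D h = coins_M \<Otimes>\<^sub>M cands_M D h"

definition exp_cost :: "real \<Rightarrow> real \<Rightarrow> real measure \<Rightarrow> (real \<Rightarrow> real) \<Rightarrow> policy \<Rightarrow> ennreal" where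
  "exp_cost cr cv D h pol = (\<integral>\<^sup>+ x. cost cr cv pol (fst x) (snd x) \<partial>joint_M D h)"

definition admissible :: "real \<Rightarrow> real \<Rightarrow> real measure \<Rightarrow> (real \<Rightarrow> real) \<Rightarrow> policy \<Rightarrow> bool" where
  "admissible cr cv D h pol =
     ((\<lambda>x. cost cr cv pol (fst x) (snd x)) \<in> borel_measurable (joint_M D h))"

definition Jstar :: "real \<Rightarrow> real \<Rightarrow> real measure \<Rightarrow> (real \<Rightarrow> real) \<Rightarrow> ennreal" where
  "Jstar cr cv D h = (INF pol \<in> {pol. admissible cr cv D h pol}. exp_cost cr cv D h pol)"

definition S_set :: "real \<Rightarrow> real \<Rightarrow> nat \<Rightarrow> (nat \<times> nat) set" where
  "S_set cr cv s = {(a, b). a \<le> b \<and>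
      2 ^ s * min cr cv \<le> cr * 2 ^ b + cv * 2 ^ (b - a) \<and>
      cr * 2 ^ b + cv * 2 ^ (b - a) < 2 ^ (s + 1) * min cr cv}"

definition m_shell :: "real \<Rightarrow> real \<Rightarrow> nat \<Rightarrow> nat" where
  "m_shell cr cv s = nat \<lceil>(2::real) ^ (Max (snd ` S_set cr cv s) + 1)\<rceil>"

definition k_shell :: "real \<Rightarrow> real \<Rightarrow> nat \<Rightarrow> nat" where
  "k_shell cr cv s = nat \<lceil>6 * (2::real) ^ (Max ((\<lambda>(a, b). b - a) ` S_set cr cv s))\<rceil>"

text \<open>Action types (True = generate, False = verify) of shells 0..<s, together with the
  number of generations and verifications performed so far.  Since all verifications
  before stopping are negative, the pool size is determined by these counts.\<close>
fun adap_blocks :: "real \<Rightarrow> real \<Rightarrow> nat \<Rightarrow> bool list \<times> nat \<times> nat" where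
  "adap_blocks cr cv 0 = ([], 0, 0)"
| "adap_blocks cr cv (Suc s) =
     (case adap_blocks cr cv s of (L, G, W) \<Rightarrow>
       if S_set cr cv s = {} then (L, G, W)
       else (let G' = G + m_shell cr cv s; v = min (k_shell cr cv s) (G' - W) in
             (L @ replicate (m_shell cr cv s) True @ replicate v False, G', W + v)))"

definition adap_gen_at :: "real \<Rightarrow> real \<Rightarrow> nat \<Rightarrow> bool" where
  "adap_gen_at cr cv n =
     (let N = (LEAST N. n < length (fst (adap_blocks cr cv N))) in fst (adap_blocks cr cv N) ! n)"

definition adap_top :: "event list \<Rightarrow> nat" where
  "adap_top h = (LEAST i. i \<in> pool h \<and> (\<forall>j\<in>pool h. gen_scores h ! j \<le> gen_scores h ! i))"

definition adap_policy :: "real \<Rightarrow> real \<Rightarrow> policy" where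
  "adap_policy cr cv = (\<lambda>u h. if adap_gen_at cr cv (length h) then Generate else Verify (adap_top h))"

end

theory Submission
  imports Defs
begin

text \<open>
  Let \<open>lam > 0\<close> solve \<open>E (lam * h R - cv)\<^sup>+ = cr\<close> and put \<open>A = {lam * h > cv}\<close>, \<open>q = P (R \<in> A)\<close>,
  \<open>F = E (h R; R \<in> A)\<close>, so that \<open>lam * F = cr + cv * q\<close>.

  Lower bound: a generated candidate is worth at most \<open>(lam * h R - cv)\<^sup>+\<close> beyond the cost of its
  verification, and its score is independent of whether the search is still running when it is
  generated. Hence no policy, whatever it knows, has expected cost below \<open>lam\<close>.

  Upper bound: take \<open>2 ^ -a \<approx> q\<close> and \<open>2 ^ b \<approx> 1 / F\<close>; the pair \<open>(a, b)\<close> costs at most \<open>4 * lam\<close>,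
  and \<open>(a, b + i)\<close> lies \<open>i\<close> shells further. In each such shell the top \<open>k\<close> of the pool dominate the
  top \<open>k\<close> of the fresh candidates, which contain all fresh candidates in \<open>A\<close> unless there are more
  than \<open>k\<close> of these; so the shell fails with probability at most \<open>e\<^sup>-\<^sup>2 + e\<^sup>4 / 3\<^sup>6 < 3/8\<close>, independently
  of the past. As shell costs double, the expected total is a convergent geometric series.
\<close>

section \<open>The law of the candidate sequence\<close>

text \<open>\<open>lam\<close> can be read as the price of a threshold search: verifying exactly the
  candidates with score in A costs \<open>cr + cv * q\<close> per generation and succeeds with
  probability F, hence \<open>(cr + cv * q) / F\<close> on average. For the upper bound the obstacle
  is the pool. Candidates left over from earlier shells stay in it after a selection by score, so
  consecutive shells are not independent and the law of the pool is out of reach. The labels are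
  therefore averaged out before anything is estimated: given all scores, the probability that every
  verification so far failed is the product of \<open>1 - h\<close> over the verified candidates.
  Passing to the next shell multiplies this product by a factor bounded pointwise by a function of
  fresh scores alone, and the product law separates that function from the past. Monotonicity of h
  enters only there, to make the order by score an order by h. Constants: a shell costs at most
  \<open>16 * 2 ^ s * cmin\<close>. The rate 3/8 is below 1/2, so it beats the doubling, with ratio
  3/4. The shells before \<open>s0\<close> contribute a factor 1 and those from \<open>s0\<close> on
  a factor 4, which gives \<open>80 * 2 ^ s0 * cmin\<close>; with
  \<open>2 ^ s0 * cmin \<le> 4 * lam\<close> the total is at most \<open>320 * lam\<close>.\<close>

locale search_instance =
  fixes D :: "real measure" and h :: "real \<Rightarrow> real"
  assumes prob_space_D: "prob_space D"
    and sets_D [measurable_cong]: "sets D = sets borel"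
    and measurable_h [measurable]: "h \<in> borel_measurable borel"
    and h_range: "\<And>r. 0 \<le> h r \<and> h r \<le> 1"
begin

sublocale D: prob_space D
  by (rule prob_space_D)

lemma h_nonneg [simp]: "0 \<le> h r" and h_le_1 [simp]: "h r \<le> 1"
  using h_range by auto

definition label_prob :: "bool \<Rightarrow> real \<Rightarrow> real" where
  "label_prob c r = (if c then h r else 1 - h r)"

lemma label_prob_nonneg [simp]: "0 \<le> label_prob c r"
  by (simp add: label_prob_def)

lemma measurable_label_prob [measurable]: "label_prob c \<in> borel_measurable borel"
  unfolding label_prob_def by measurable

lemma space_D: "space D = UNIV"
  using sets_eq_imp_space_eq[OF sets_D] by simp

lemma sets_cand_measure [measurable_cong]:
  "sets (cand_measure D h) = sets (borel \<Otimes>\<^sub>M count_space UNIV)"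
  unfolding cand_measure_def sets_density
  by (rule sets_pair_measure_cong) (auto simp: sets_D)

lemma nn_integral_cand_measure:
  assumes f [measurable]: "f \<in> borel_measurable (borel \<Otimes>\<^sub>M count_space UNIV)"
  shows "(\<integral>\<^sup>+ y. f y \<partial>cand_measure D h) =
    (\<integral>\<^sup>+ r. (\<Sum>b\<in>UNIV. ennreal (label_prob b r) * f (r, b)) \<partial>D)"
proof -
  interpret B: sigma_finite_measure "count_space (UNIV :: bool set)"
    by (rule sigma_finite_measure_count_space)
  have "(\<integral>\<^sup>+ y. f y \<partial>cand_measure D h) =
      (\<integral>\<^sup>+ (r, b). ennreal (label_prob b r) * f (r, b) \<partial>(D \<Otimes>\<^sub>M count_space UNIV))"
    unfolding cand_measure_def
    by (subst nn_integral_density) (auto simp: case_prod_beta label_prob_def intro!: nn_integral_cong)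
  also have "\<dots> = (\<integral>\<^sup>+ r. (\<integral>\<^sup>+ b. ennreal (label_prob b r) * f (r, b) \<partial>count_space UNIV) \<partial>D)"
    by (subst B.nn_integral_fst[symmetric])
      (auto simp: case_prod_beta label_prob_def intro!: nn_integral_cong)
  also have "\<dots> = (\<integral>\<^sup>+ r. (\<Sum>b\<in>UNIV. ennreal (label_prob b r) * f (r, b)) \<partial>D)"
    by (simp add: nn_integral_count_space_finite)
  finally show ?thesis .
qed

lemma nn_integral_cand_measure_fst:
  assumes [measurable]: "g \<in> borel_measurable borel"
  shows "(\<integral>\<^sup>+ y. g (fst y) \<partial>cand_measure D h) = (\<integral>\<^sup>+ r. g r \<partial>D)"
proof -
  have "ennreal (h r) * g r + ennreal (1 - h r) * g r = g r" for r
    by (simp add: distrib_right[symmetric] ennreal_plus[symmetric] del: ennreal_plus)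
  then show ?thesis
    by (subst nn_integral_cand_measure) (auto simp: UNIV_bool label_prob_def add.commute)
qed

lemma prob_space_cand_measure: "prob_space (cand_measure D h)"
  using nn_integral_cand_measure_fst[of "\<lambda>_. 1"]
  by (intro prob_spaceI) (simp add: D.emeasure_space_1)

lemma emeasure_cand_measure_snd: "emeasure (cand_measure D h) {x. snd x} = (\<integral>\<^sup>+ r. h r \<partial>D)"
proof -
  have "{x :: real \<times> bool. snd x} = UNIV \<times> {True}"
    by auto
  then have meas [measurable]: "{x :: real \<times> bool. snd x} \<in> sets (borel \<Otimes>\<^sub>M count_space UNIV)"
    by simp
  have "emeasure (cand_measure D h) {x. snd x} = (\<integral>\<^sup>+ y. indicator {x. snd x} y \<partial>cand_measure D h)"
    by (subst nn_integral_indicator) (simp_all add: sets_cand_measure meas)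
  also have "\<dots> = (\<integral>\<^sup>+ r. h r \<partial>D)"
  proof -
    have "(\<Sum>b\<in>UNIV. ennreal (label_prob b r) * indicator {x. snd x} (r, b)) = ennreal (h r)" for r
      by (simp add: UNIV_bool label_prob_def del: sum_mult_indicator)
    then show ?thesis
      by (subst nn_integral_cand_measure) simp_all
  qed
  finally show ?thesis .
qed

lemma sets_cands_M [measurable_cong]:
  "sets (cands_M D h) = sets (PiM UNIV (\<lambda>_. borel \<Otimes>\<^sub>M count_space UNIV))"
  unfolding cands_M_def by (intro sets_PiM_cong) (auto simp: sets_cand_measure)

sublocale cands: prob_space "cands_M D h"
  unfolding cands_M_def by (intro prob_space_PiM prob_space_cand_measure)

text \<open>Overwriting one coordinate by an independent copy preserves the product law. Every
  independence argument below is this identity followed by an evaluation of the inner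
  integral.\<close>

lemma nn_integral_cands_resample:
  assumes F [measurable]: "F \<in> borel_measurable (cands_M D h)"
  shows "(\<integral>\<^sup>+ w. F w \<partial>cands_M D h) = (\<integral>\<^sup>+ w. (\<integral>\<^sup>+ y. F (w(i := y)) \<partial>cand_measure D h) \<partial>cands_M D h)"
proof -
  let ?M = "cand_measure D h" and ?P = "cands_M D h"
  interpret M: prob_space ?M by (rule prob_space_cand_measure)
  interpret MP: pair_sigma_finite ?M ?P ..
  have upd [measurable]: "(\<lambda>(y, w). w(i := y)) \<in> measurable (?M \<Otimes>\<^sub>M ?P) ?P"
    unfolding cands_M_def case_prod_beta
    by (rule measurable_fun_upd[where J=UNIV]) auto
  have eq: "distr (?M \<Otimes>\<^sub>M ?P) ?P (\<lambda>(y, w). w(i := y)) = ?P"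
    using distr_pair_PiM_eq_PiM[of UNIV "\<lambda>_. ?M" i] prob_space_cand_measure
    unfolding cands_M_def by simp
  have "(\<integral>\<^sup>+ w. F w \<partial>?P) = (\<integral>\<^sup>+ z. F (case z of (y, w) \<Rightarrow> w(i := y)) \<partial>(?M \<Otimes>\<^sub>M ?P))"
    by (subst eq[symmetric], subst nn_integral_distr) auto
  also have "\<dots> = (\<integral>\<^sup>+ w. (\<integral>\<^sup>+ y. F (w(i := y)) \<partial>?M) \<partial>?P)"
    by (subst MP.nn_integral_snd[symmetric]) auto
  finally show ?thesis .
qed

lemma measurable_score [measurable]: "(\<lambda>w. fst (w i)) \<in> borel_measurable (cands_M D h)"
  and measurable_label [measurable]: "(\<lambda>w. snd (w i)) \<in> measurable (cands_M D h) (count_space UNIV)"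
  by measurable

lemma measurable_upd_cands:
  assumes "F \<in> borel_measurable (cands_M D h)"
  shows "(\<lambda>y. F (w(i := y))) \<in> borel_measurable (borel \<Otimes>\<^sub>M count_space UNIV)"
proof -
  have "(\<lambda>y. w(i := y)) \<in> measurable (borel \<Otimes>\<^sub>M count_space UNIV) (PiM UNIV (\<lambda>_. borel \<Otimes>\<^sub>M count_space UNIV))"
    by (rule measurable_fun_upd[where J=UNIV]) (auto simp: space_PiM space_pair_measure)
  then have "(\<lambda>y. w(i := y)) \<in> measurable (borel \<Otimes>\<^sub>M count_space UNIV) (cands_M D h)"
    by (simp cong: measurable_cong_sets add: sets_cands_M)
  from measurable_compose[OF this assms] show ?thesis .
qed

text \<open>Independence is expressed pointwise: F ignores coordinate i, so it leaves the inner
  integral after resampling that coordinate.\<close>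

lemma nn_integral_cands_factor:
  assumes F [measurable]: "F \<in> borel_measurable (cands_M D h)"
    and indep: "\<And>w y. F (w(i := y)) = F w"
    and g [measurable]: "g \<in> borel_measurable borel"
  shows "(\<integral>\<^sup>+ w. F w * g (fst (w i)) \<partial>cands_M D h) = (\<integral>\<^sup>+ w. F w \<partial>cands_M D h) * (\<integral>\<^sup>+ r. g r \<partial>D)"
proof -
  have "(\<integral>\<^sup>+ w. F w * g (fst (w i)) \<partial>cands_M D h) =
      (\<integral>\<^sup>+ w. (\<integral>\<^sup>+ y. F w * g (fst y) \<partial>cand_measure D h) \<partial>cands_M D h)"
    by (subst nn_integral_cands_resample[of _ i]) (simp_all add: indep)
  also have "\<dots> = (\<integral>\<^sup>+ w. F w * (\<integral>\<^sup>+ r. g r \<partial>D) \<partial>cands_M D h)"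
    by (subst nn_integral_cmult) (simp_all add: nn_integral_cand_measure_fst)
  finally show ?thesis by (simp add: nn_integral_multc)
qed

lemma nn_integral_cands_factor_prod:
  assumes F: "F \<in> borel_measurable (cands_M D h)"
    and indep: "\<And>w y i. i \<in> J \<Longrightarrow> F (w(i := y)) = F w"
    and g [measurable]: "g \<in> borel_measurable borel" and "finite J"
  shows "(\<integral>\<^sup>+ w. F w * (\<Prod>i\<in>J. g (fst (w i))) \<partial>cands_M D h) =
    (\<integral>\<^sup>+ w. F w \<partial>cands_M D h) * (\<integral>\<^sup>+ r. g r \<partial>D) ^ card J"
  using \<open>finite J\<close> indep
proof (induction J)
  case (insert i J)
  note [measurable] = F
  have "(\<integral>\<^sup>+ w. F w * (\<Prod>i\<in>insert i J. g (fst (w i))) \<partial>cands_M D h) =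
      (\<integral>\<^sup>+ w. (F w * (\<Prod>i\<in>J. g (fst (w i)))) * g (fst (w i)) \<partial>cands_M D h)"
    using insert.hyps by (simp add: mult_ac)
  also have "\<dots> = (\<integral>\<^sup>+ w. F w * (\<Prod>i\<in>J. g (fst (w i))) \<partial>cands_M D h) * (\<integral>\<^sup>+ r. g r \<partial>D)"
  proof (rule nn_integral_cands_factor)
    show "F (w(i := y)) * (\<Prod>ia\<in>J. g (fst ((w(i := y)) ia))) = F w * (\<Prod>i\<in>J. g (fst (w i)))" for w y
    proof -
      have "F (w(i := y)) = F w"
        by (rule insert.prems) simp
      then show ?thesis
        using insert.hyps by (auto intro!: arg_cong2[where f="(*)"] prod.cong)
    qed
  qed simp_all
  also have "\<dots> = (\<integral>\<^sup>+ w. F w \<partial>cands_M D h) * (\<integral>\<^sup>+ r. g r \<partial>D) ^ card (insert i J)"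
    using insert by (simp add: mult_ac)
  finally show ?case .
qed simp

text \<open>Conditioning on the score of candidate i: F may depend on that score but not on the
  label, so the label is replaced by its conditional probability. In the resampled integral the
  weights of the two labels add up to 1.\<close>

lemma nn_integral_cands_label:
  assumes F [measurable]: "F \<in> borel_measurable (cands_M D h)"
    and indep: "\<And>w r b b'. F (w(i := (r, b))) = F (w(i := (r, b')))"
  shows "(\<integral>\<^sup>+ w. F w * of_bool (snd (w i) = c) \<partial>cands_M D h) =
    (\<integral>\<^sup>+ w. F w * ennreal (label_prob c (fst (w i))) \<partial>cands_M D h)"
proof -
  have "(\<integral>\<^sup>+ y. F (w(i := y)) * of_bool (snd y = c) \<partial>cand_measure D h) =
      (\<integral>\<^sup>+ y. F (w(i := y)) * ennreal (label_prob c (fst y)) \<partial>cand_measure D h)" for w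
  proof -
    have [measurable]: "(\<lambda>y. F (w(i := y))) \<in> borel_measurable (borel \<Otimes>\<^sub>M count_space UNIV)"
      by (rule measurable_upd_cands) fact
    have "ennreal (label_prob True r) + ennreal (label_prob False r) = 1" for r
      by (simp add: label_prob_def ennreal_plus[symmetric] del: ennreal_plus)
    then have *: "ennreal (label_prob True r) * (x * z) + ennreal (label_prob False r) * (x * z) = x * z" for r x z
      by (metis distrib_right mult_1)
    have "(\<Sum>b\<in>UNIV. ennreal (label_prob b r) * (F (w(i := (r, b))) * of_bool (b = c))) =
        (\<Sum>b\<in>UNIV. ennreal (label_prob b r) * (F (w(i := (r, b))) * ennreal (label_prob c r)))" for r
      using indep[of w r True False] *[of r "F (w(i := (r, False)))" "ennreal (label_prob c r)"]
      by (cases c) (simp_all add: UNIV_bool add.commute mult.commute)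
    then show ?thesis
      by (subst (1 2) nn_integral_cand_measure) simp_all
  qed
  then show ?thesis
    by (subst (1 2) nn_integral_cands_resample[of _ i]) simp_all
qed

end

section \<open>Runs on which every label is negative\<close>

text \<open>Until its first success a run coincides with the run in which all labels are negative, and
  the latter is a function of the scores alone.\<close>

definition hide_labels :: "(nat \<Rightarrow> real \<times> bool) \<Rightarrow> nat \<Rightarrow> real \<times> bool" where
  "hide_labels w = (\<lambda>i. (fst (w i), False))"

definition valid_until :: "policy \<Rightarrow> (nat \<Rightarrow> bool) \<Rightarrow> (nat \<Rightarrow> real \<times> bool) \<Rightarrow> nat \<Rightarrow> bool" where
  "valid_until pol u w t = (\<forall>s<t. valid_action (run pol u w s) (act pol u w s))"

lemma gen_scores_append: "gen_scores (xs @ ys) = gen_scores xs @ gen_scores ys"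
  by (induction xs rule: gen_scores.induct) auto

lemma verified_append: "verified (xs @ ys) = verified xs \<union> verified ys"
  by (induction xs rule: verified.induct) auto

lemma run_Suc_act:
  "run pol u w (Suc t) = run pol u w t @ [next_event w (run pol u w t) (act pol u w t)]"
  by (simp add: act_def)

lemma gen_scores_run_Suc:
  "gen_scores (run pol u w (Suc t)) = gen_scores (run pol u w t) @
    (case act pol u w t of Generate \<Rightarrow> [fst (w (length (gen_scores (run pol u w t))))] | Verify i \<Rightarrow> [])"
  unfolding run_Suc_act gen_scores_append by (simp add: next_event_def split: action.split)

lemma verified_run_Suc:
  "verified (run pol u w (Suc t)) = verified (run pol u w t) \<union>
    (case act pol u w t of Generate \<Rightarrow> {} | Verify i \<Rightarrow> {i})"
  unfolding run_Suc_act verified_append by (simp add: next_event_def split: action.split)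

lemma verified_run: "verified (run pol u w t) = {i. \<exists>s<t. act pol u w s = Verify i}"
proof (induction t)
  case (Suc t)
  show ?case
    unfolding verified_run_Suc Suc.IH by (auto simp: less_Suc_eq split: action.splits)
qed simp

lemma finite_verified_run: "finite (verified (run pol u w t))"
  by (induction t) (auto simp: verified_run_Suc simp del: run.simps(2) split: action.split)

lemma gen_scores_run_mono:
  "s \<le> t \<Longrightarrow> length (gen_scores (run pol u w s)) \<le> length (gen_scores (run pol u w t))"
  by (induction t rule: dec_induct) (auto simp: gen_scores_run_Suc simp del: run.simps)

text \<open>A valid verification removes its candidate from the pool, so no candidate is verified
  twice and the cardinality of the verified set counts the verification steps.\<close>

lemma sum_step_cost:
  assumes "valid_until pol u w t"
  shows "(\<Sum>s<t. step_cost cr cv (act pol u w s)) =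
    cr * real (length (gen_scores (run pol u w t))) + cv * real (card (verified (run pol u w t)))"
  using assms
proof (induction t)
  case (Suc t)
  from Suc.prems have v: "valid_until pol u w t" and a: "valid_action (run pol u w t) (act pol u w t)"
    by (auto simp: valid_until_def)
  have "i \<notin> verified (run pol u w t)" if "act pol u w t = Verify i" for i
    using a that by (auto simp: valid_action_def pool_def)
  then show ?case
    using Suc.IH[OF v] finite_verified_run[of pol u w t]
    unfolding gen_scores_run_Suc verified_run_Suc
    by (auto simp: step_cost_def algebra_simps split: action.splits)
qed simp

lemma hide_labels_simps [simp]: "fst (hide_labels w i) = fst (w i)" "snd (hide_labels w i) = False"
  by (auto simp: hide_labels_def)

lemma run_hide_labels:
  assumes "\<And>s i. s < t \<Longrightarrow> act pol u (hide_labels w) s = Verify i \<Longrightarrow> \<not> snd (w i)"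
  shows "run pol u w t = run pol u (hide_labels w) t"
  using assms
proof (induction t)
  case (Suc t)
  have IH: "run pol u w t = run pol u (hide_labels w) t"
    using Suc by (meson less_Suc_eq)
  show ?case
    using Suc.prems[of t]
    by (auto simp: IH act_def next_event_def hide_labels_def split: action.splits)
qed simp

text \<open>A version of \<open>success\<close> whose action is taken from the run with hidden
  labels: the labels enter only through the final test, the choice of i only through scores and
  coins.\<close>

definition hits :: "policy \<Rightarrow> (nat \<Rightarrow> bool) \<Rightarrow> (nat \<Rightarrow> real \<times> bool) \<Rightarrow> nat \<Rightarrow> bool" where
  "hits pol u w t = (\<exists>i. act pol u (hide_labels w) t = Verify i \<and> snd (w i))"

lemma run_hide_labels_no_hit:
  assumes "\<And>s. s < t \<Longrightarrow> \<not> hits pol u w s"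
  shows "run pol u w t = run pol u (hide_labels w) t"
  using assms by (intro run_hide_labels) (auto simp: hits_def)

lemma success_iff_hits:
  assumes "\<And>s. s < t \<Longrightarrow> \<not> hits pol u w s"
  shows "success pol u w t = hits pol u w t"
  using run_hide_labels_no_hit[OF assms]
  by (auto simp: success_def hits_def act_def split: action.splits)

lemma no_success_iff_no_hits:
  "(\<forall>s<t. \<not> success pol u w s) \<longleftrightarrow> (\<forall>s<t. \<not> hits pol u w s)"
  by (induction t) (use success_iff_hits in \<open>auto simp: less_Suc_eq\<close>)

text \<open>\<open>success\<close> and \<open>hits\<close> may disagree after a success, but their
  first occurrences coincide, and the cost depends on nothing else.\<close>

lemma first_success_iff:
  "success pol u w t \<and> (\<forall>s<t. \<not> success pol u w s) \<longleftrightarrow> hits pol u w t \<and> (\<forall>s<t. \<not> hits pol u w s)"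
  using no_success_iff_no_hits[of t pol u w] success_iff_hits[of t pol u w] by blast

lemma cost_first_hit:
  assumes hit: "hits pol u w t" and first: "\<And>s. s < t \<Longrightarrow> \<not> hits pol u w s"
  shows "cost cr cv pol u w = (if valid_until pol u (hide_labels w) (Suc t)
    then ennreal (\<Sum>s\<le>t. step_cost cr cv (act pol u (hide_labels w) s)) else \<infinity>)"
proof -
  have s: "success pol u w t" "\<And>s. s < t \<Longrightarrow> \<not> success pol u w s"
    using first_success_iff[of pol u w t] assms by auto
  then have L: "(LEAST t. success pol u w t) = t"
    by (intro Least_equality) (auto simp: not_less[symmetric])
  have r: "run pol u w s = run pol u (hide_labels w) s" if "s \<le> t" for s
    using that first by (intro run_hide_labels_no_hit) auto
  then have a: "act pol u w s = act pol u (hide_labels w) s" if "s \<le> t" for s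
    using that by (simp add: act_def)
  show ?thesis
    using s(1) r a unfolding cost_def L
    by (auto simp: valid_until_def less_Suc_eq_le Let_def)
qed

lemma cost_no_hit: "\<forall>t. \<not> hits pol u w t \<Longrightarrow> cost cr cv pol u w = \<infinity>"
  using no_success_iff_no_hits unfolding cost_def by (meson lessI)

lemma cost_finite_obtains_hit:
  assumes "cost cr cv pol u w < \<infinity>"
  obtains t where "hits pol u w t" "\<And>s. s < t \<Longrightarrow> \<not> hits pol u w s" "valid_until pol u (hide_labels w) (Suc t)"
    "cost cr cv pol u w = ennreal (\<Sum>s\<le>t. step_cost cr cv (act pol u (hide_labels w) s))"
proof -
  have "\<exists>t. hits pol u w t"
    using assms cost_no_hit[of pol u w cr cv] by (metis infinity_ennreal_def less_irrefl)
  then obtain t where t: "hits pol u w t" "\<And>s. s < t \<Longrightarrow> \<not> hits pol u w s"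
    using exists_least_iff[of "hits pol u w"] by blast
  with cost_first_hit[OF t, of cr cv] assms show ?thesis
    by (intro that[of t]) (auto split: if_splits)
qed

section \<open>Lower bound for arbitrary policies\<close>

locale cost_params =
  fixes cr cv :: real
  assumes cr_pos: "cr > 0" and cv_pos: "cv > 0"

text \<open>The coins are frozen: the lower bound is proved for each u separately and averaged over
  the coins in \<open>Jstar_ge\<close>.\<close>

locale fixed_policy = cost_params +
  fixes pol :: policy and u :: "nat \<Rightarrow> bool"
begin

text \<open>Admissibility only makes the cost measurable, not the actions of the policy. The cost \<open>K i\<close>
  of a run whose only positive candidate is \<open>i\<close> is a section of the cost, hence measurable. The
  order of the verifications, and the number of generations preceding each of them, can be read
  off the family \<open>K\<close>; so \<open>early\<close>, \<open>reached\<close> and \<open>alive\<close> are defined through \<open>K\<close> rather than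
  through the run.\<close>

definition solo :: "nat \<Rightarrow> (nat \<Rightarrow> real \<times> bool) \<Rightarrow> nat \<Rightarrow> real \<times> bool" where
  "solo i w = (\<lambda>j. (fst (w j), j = i))"

definition K :: "nat \<Rightarrow> (nat \<Rightarrow> real \<times> bool) \<Rightarrow> ennreal" where
  "K i w = cost cr cv pol u (solo i w)"

definition path_cost :: "(nat \<Rightarrow> real \<times> bool) \<Rightarrow> nat \<Rightarrow> real" where
  "path_cost w t = (\<Sum>s\<le>t. step_cost cr cv (act pol u (hide_labels w) s))"

definition verifies_at :: "(nat \<Rightarrow> real \<times> bool) \<Rightarrow> nat \<Rightarrow> nat \<Rightarrow> bool" where
  "verifies_at w i t \<longleftrightarrow> act pol u (hide_labels w) t = Verify i \<and> valid_until pol u (hide_labels w) (Suc t)"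

definition num_gen :: "(nat \<Rightarrow> real \<times> bool) \<Rightarrow> nat \<Rightarrow> nat" where
  "num_gen w t = length (gen_scores (run pol u (hide_labels w) t))"

definition verif_rank :: "nat \<Rightarrow> (nat \<Rightarrow> real \<times> bool) \<Rightarrow> ennreal" where
  "verif_rank j w = (\<Sum>l. of_bool (K l w < K j w))"

\<comment> \<open>\<open>j\<close> is verified before candidate \<open>n\<close> is generated, see \<open>early_iff\<close>.\<close>
definition early :: "nat \<Rightarrow> nat \<Rightarrow> (nat \<Rightarrow> real \<times> bool) \<Rightarrow> bool" where
  "early n j w \<longleftrightarrow> K j w < \<infinity> \<and> K j w \<le> ennreal (cr * real n) + ennreal cv * (1 + verif_rank j w)"

\<comment> \<open>The search is still running when it comes to verify \<open>i\<close>.\<close>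
definition reached :: "nat \<Rightarrow> (nat \<Rightarrow> real \<times> bool) \<Rightarrow> bool" where
  "reached i w \<longleftrightarrow> K i w < \<infinity> \<and> (\<forall>j. K j w < K i w \<longrightarrow> \<not> snd (w j))"

\<comment> \<open>No success has occurred before candidate \<open>n\<close> is generated.\<close>
definition alive :: "nat \<Rightarrow> (nat \<Rightarrow> real \<times> bool) \<Rightarrow> bool" where
  "alive n w \<longleftrightarrow> (\<forall>j. early n j w \<longrightarrow> \<not> snd (w j))"

lemma step_cost_pos: "0 < step_cost cr cv a"
  using cr_pos cv_pos by (auto simp: step_cost_def split: action.split)

lemma path_cost_strict_mono: "strict_mono (path_cost w)"
  unfolding strict_mono_Suc_iff path_cost_def using step_cost_pos by simp

text \<open>The accumulated cost serves as a clock: as both prices are positive, comparing costs is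
  comparing times.\<close>

lemma path_cost_less_iff: "ennreal (path_cost w s) < ennreal (path_cost w t) \<longleftrightarrow> s < t"
proof -
  have "0 \<le> path_cost w s"
    unfolding path_cost_def by (intro sum_nonneg less_imp_le step_cost_pos)
  then show ?thesis
    by (simp add: ennreal_less_iff strict_mono_less[OF path_cost_strict_mono])
qed

lemma hide_labels_solo [simp]: "hide_labels (solo i w) = hide_labels w"
  by (simp add: hide_labels_def solo_def)

lemma hits_solo: "hits pol u (solo i w) t \<longleftrightarrow> act pol u (hide_labels w) t = Verify i"
  unfolding hits_def hide_labels_solo by (auto simp: solo_def)

text \<open>An already verified candidate is no longer in the pool, so validity makes the
  verification time of i unique.\<close>

lemma verifies_at_fresh:
  assumes "verifies_at w i t" "s < t"
  shows "act pol u (hide_labels w) s \<noteq> Verify i"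
  using assms by (auto simp: verifies_at_def valid_until_def valid_action_def pool_def verified_run)

lemma K_verifies_at:
  assumes "verifies_at w i t"
  shows "K i w = ennreal (path_cost w t)"
  unfolding K_def using assms verifies_at_fresh[OF assms]
  by (subst cost_first_hit[of _ _ _ t]) (auto simp: hits_solo verifies_at_def path_cost_def)

lemma K_finite_obtains:
  assumes "K i w < \<infinity>"
  obtains t where "verifies_at w i t" "K i w = ennreal (path_cost w t)"
  using assms unfolding K_def
  by (rule cost_finite_obtains_hit) (auto simp: hits_solo verifies_at_def path_cost_def)

lemma K_finite_iff: "K i w < \<infinity> \<longleftrightarrow> (\<exists>t. verifies_at w i t)"
  by (metis K_finite_obtains K_verifies_at ennreal_less_top infinity_ennreal_def)

lemma valid_until_mono: "valid_until pol u w t \<Longrightarrow> s \<le> t \<Longrightarrow> valid_until pol u w s"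
  by (auto simp: valid_until_def)

lemma K_less_iff:
  assumes "verifies_at w j t"
  shows "K l w < K j w \<longleftrightarrow> (\<exists>s<t. verifies_at w l s)"
proof
  assume *: "K l w < K j w"
  then have "K l w < \<infinity>"
    by (simp add: order.strict_trans2)
  then obtain s where s: "verifies_at w l s" "K l w = ennreal (path_cost w s)"
    by (rule K_finite_obtains)
  with * show "\<exists>s<t. verifies_at w l s"
    by (auto simp: K_verifies_at[OF assms] path_cost_less_iff)
next
  assume "\<exists>s<t. verifies_at w l s"
  then show "K l w < K j w"
    by (auto simp: K_verifies_at[OF assms] K_verifies_at path_cost_less_iff)
qed

lemma verif_rank_verifies_at:
  assumes "verifies_at w j t"
  shows "verif_rank j w = of_nat (card (verified (run pol u (hide_labels w) t)))"
proof -
  let ?V = "verified (run pol u (hide_labels w) t)"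
  have "K l w < K j w \<longleftrightarrow> l \<in> ?V" for l
    unfolding K_less_iff[OF assms] verified_run
    using assms by (auto simp: verifies_at_def valid_until_def)
  then have "verif_rank j w = (\<Sum>l. of_bool (l \<in> ?V))"
    by (simp add: verif_rank_def)
  also have "\<dots> = (\<Sum>l\<in>?V. of_bool (l \<in> ?V))"
    by (rule suminf_finite) (auto simp: finite_verified_run)
  finally show ?thesis
    by simp
qed

lemma path_cost_eq:
  assumes "verifies_at w j t"
  shows "path_cost w t = cr * real (num_gen w t) + cv * (1 + real (card (verified (run pol u (hide_labels w) t))))"
proof -
  have "path_cost w t = (\<Sum>s<t. step_cost cr cv (act pol u (hide_labels w) s)) + cv"
    using assms by (simp add: path_cost_def verifies_at_def step_cost_def lessThan_Suc_atMost[symmetric])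
  then show ?thesis
    using assms by (subst (asm) sum_step_cost)
      (auto simp: verifies_at_def num_gen_def algebra_simps intro: valid_until_mono)
qed

text \<open>At its verification, \<open>K j\<close> is \<open>cr\<close> times the number of
  generations plus \<open>cv\<close> times one more than the number of earlier verifications, the
  one being for j itself. The rank in \<open>early\<close> cancels the second part, and what remains
  compares numbers of generations.\<close>

lemma early_iff: "early n j w \<longleftrightarrow> (\<exists>t. verifies_at w j t \<and> num_gen w t \<le> n)"
proof -
  have *: "early n j w \<longleftrightarrow> num_gen w t \<le> n" if t: "verifies_at w j t" for t
  proof -
    let ?c = "card (verified (run pol u (hide_labels w) t))"
    have "ennreal (cr * real n) + ennreal cv * (1 + verif_rank j w) = ennreal (cr * real n + cv * (1 + real ?c))"
      using cr_pos cv_pos unfolding verif_rank_verifies_at[OF t] ennreal_of_nat_eq_real_of_nat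
      by (simp add: ennreal_mult' ennreal_plus)
    then have "early n j w \<longleftrightarrow> ennreal (path_cost w t) \<le> ennreal (cr * real n + cv * (1 + real ?c))"
      by (simp add: early_def K_verifies_at[OF t])
    also have "\<dots> \<longleftrightarrow> cr * real (num_gen w t) \<le> cr * real n"
      unfolding path_cost_eq[OF t] using cr_pos cv_pos by (subst ennreal_le_iff) auto
    finally show ?thesis
      using cr_pos by simp
  qed
  have "early n j w \<Longrightarrow> \<exists>t. verifies_at w j t"
    unfolding early_def K_finite_iff by blast
  with * show ?thesis
    by blast
qed

lemma verifies_at_less_num_gen: "verifies_at w i t \<Longrightarrow> i < num_gen w t"
  by (auto simp: verifies_at_def valid_until_def valid_action_def pool_def num_gen_def)

lemma num_gen_mono: "s \<le> t \<Longrightarrow> num_gen w s \<le> num_gen w t"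
  unfolding num_gen_def by (rule gen_scores_run_mono)

text \<open>Candidate i is generated before it is verified, so whatever is verified before its
  generation also precedes its verification.\<close>

lemma reached_imp_alive:
  assumes "reached i w"
  shows "alive i w"
  unfolding alive_def
proof (intro allI impI)
  fix j assume "early i j w"
  then obtain s where s: "verifies_at w j s" "num_gen w s \<le> i"
    by (auto simp: early_iff)
  from assms obtain t where t: "verifies_at w i t"
    unfolding reached_def K_finite_iff by blast
  from verifies_at_less_num_gen[OF t] s(2) have "s < t"
    using num_gen_mono[of t s w] by (meson leD le_trans linorder_not_less order.strict_trans2)
  then have "K j w < K i w"
    using K_less_iff[OF t] s(1) by blast
  with assms show "\<not> snd (w j)"
    by (auto simp: reached_def)
qed

lemma run_cong_scores:
  assumes "\<And>i. i < n \<Longrightarrow> fst (w i) = fst (w' i)" and "num_gen w t \<le> n"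
  shows "run pol u (hide_labels w) t = run pol u (hide_labels w') t"
  using assms(2)
proof (induction t)
  case (Suc t)
  have IH: "run pol u (hide_labels w) t = run pol u (hide_labels w') t"
    using Suc num_gen_mono[of t "Suc t" w] by simp
  have "length (gen_scores (run pol u (hide_labels w) t)) < n"
    if "act pol u (hide_labels w) t = Generate"
    using Suc.prems that unfolding num_gen_def gen_scores_run_Suc by simp
  then show ?case
    using assms(1) by (auto simp: IH act_def next_event_def split: action.splits)
qed simp

lemma early_cong_scores:
  assumes eq: "\<And>i. i < n \<Longrightarrow> fst (w i) = fst (w' i)" and "early n j w"
  shows "early n j w'"
proof -
  obtain t where t: "verifies_at w j t" "num_gen w t \<le> n"
    using assms(2) by (auto simp: early_iff)
  have "run pol u (hide_labels w) s = run pol u (hide_labels w') s" if "s \<le> t" for s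
    using num_gen_mono[OF that, of w] t(2) by (intro run_cong_scores[OF eq]) auto
  then have "verifies_at w' j t" "num_gen w' t \<le> n"
    using t by (auto simp: verifies_at_def valid_until_def act_def num_gen_def)
  then show ?thesis
    by (auto simp: early_iff)
qed

lemma early_less: "early n j w \<Longrightarrow> j < n"
  using verifies_at_less_num_gen by (fastforce simp: early_iff)

text \<open>What happens before candidate n is generated depends only on candidates of smaller
  index: their scores determine \<open>early n\<close>, and their labels then determine
  \<open>alive n\<close>.\<close>

lemma alive_upd: "alive n (w(n := y)) \<longleftrightarrow> alive n w"
proof -
  have "early n j (w(n := y)) \<longleftrightarrow> early n j w" for j
    by (rule iffI; rule early_cong_scores[of n]) simp_all
  then show ?thesis
    unfolding alive_def by (metis early_less fun_upd_other less_irrefl)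
qed

lemma K_upd_label: "K j (w(i := (r, b))) = K j (w(i := (r, b')))"
proof -
  have "solo j (w(i := (r, b))) = solo j (w(i := (r, b')))"
    by (auto simp: solo_def)
  then show ?thesis
    by (simp add: K_def)
qed

text \<open>\<open>K\<close> overrides all labels, and the label test in \<open>reached i\<close>
  skips i itself because its inequality is strict.\<close>

lemma reached_upd_label: "reached i (w(i := (r, b))) \<longleftrightarrow> reached i (w(i := (r, b')))"
  unfolding reached_def K_upd_label[of _ w i r b b'] by auto

lemma cost_finite_imp_reached:
  assumes "cost cr cv pol u w < \<infinity>"
  shows "\<exists>i t. reached i w \<and> snd (w i) \<and> verifies_at w i t \<and> cost cr cv pol u w = ennreal (path_cost w t)"
proof -
  obtain t where t: "hits pol u w t" "\<And>s. s < t \<Longrightarrow> \<not> hits pol u w s"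
    "valid_until pol u (hide_labels w) (Suc t)" "cost cr cv pol u w = ennreal (path_cost w t)"
    using assms by (rule cost_finite_obtains_hit) (auto simp: path_cost_def)
  then obtain i where i: "verifies_at w i t" "snd (w i)"
    by (auto simp: hits_def verifies_at_def)
  have "\<not> snd (w j)" if "K j w < K i w" for j
    using that t(2) unfolding K_less_iff[OF i(1)] by (auto simp: hits_def verifies_at_def)
  then have "reached i w"
    by (simp add: reached_def K_verifies_at[OF i(1)])
  with i t show ?thesis
    by blast
qed

text \<open>Let i be the positive candidate that ends the search. It is early for every n not
  generated by then, so such n are not alive; and its label blocks every candidate verified later.
  Hence the two series are at most the numbers of generations and verifications paid for.\<close>

lemma cost_ge_alive_reached:
  "ennreal cr * (\<Sum>n. of_bool (alive n w)) + ennreal cv * (\<Sum>i. of_bool (reached i w)) \<le> cost cr cv pol u w"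
proof (cases "cost cr cv pol u w < \<infinity>")
  case True
  then obtain i t where i: "reached i w" "snd (w i)" "verifies_at w i t"
      and cost: "cost cr cv pol u w = ennreal (path_cost w t)"
    using cost_finite_imp_reached by blast
  let ?V = "verified (run pol u (hide_labels w) t)"
  have "i \<notin> ?V"
    using verifies_at_fresh[OF i(3)] by (auto simp: verified_run)
  have "n < num_gen w t" if "alive n w" for n
    using that i by (auto simp: alive_def early_iff not_less[symmetric])
  then have "(\<Sum>n. of_bool (alive n w) :: ennreal) = (\<Sum>n<num_gen w t. of_bool (alive n w))"
    by (intro suminf_finite) auto
  also have "\<dots> \<le> (\<Sum>n<num_gen w t. 1)"
    by (intro sum_mono) simp
  finally have 1: "(\<Sum>n. of_bool (alive n w) :: ennreal) \<le> of_nat (num_gen w t)"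
    by simp
  have *: "j \<in> insert i ?V" if "reached j w" for j
  proof -
    obtain s where s: "verifies_at w j s"
      using \<open>reached j w\<close> unfolding reached_def K_finite_iff by blast
    have "\<not> t < s"
      using \<open>reached j w\<close> i K_less_iff[OF s] by (auto simp: reached_def)
    then show ?thesis
      using s i(3) by (cases "s = t") (auto simp: verifies_at_def verified_run)
  qed
  have "(\<Sum>j. of_bool (reached j w) :: ennreal) = (\<Sum>j\<in>insert i ?V. of_bool (reached j w))"
    using * by (intro suminf_finite) (auto simp: finite_verified_run)
  also have "\<dots> \<le> (\<Sum>j\<in>insert i ?V. 1)"
    by (intro sum_mono) simp
  also have "\<dots> = of_nat (1 + card ?V)"
    using \<open>i \<notin> ?V\<close> by (simp add: finite_verified_run)
  finally have 2: "(\<Sum>j. of_bool (reached j w) :: ennreal) \<le> of_nat (1 + card ?V)" .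
  have "ennreal cr * of_nat (num_gen w t) + ennreal cv * of_nat (1 + card ?V) = ennreal (path_cost w t)"
    using cr_pos cv_pos unfolding path_cost_eq[OF i(3)] ennreal_of_nat_eq_real_of_nat
    by (simp add: ennreal_mult' ennreal_plus)
  with 1 2 show ?thesis
    unfolding cost by (metis add_mono mult_left_mono zero_le)
next
  case False
  then have "cost cr cv pol u w = \<infinity>"
    using less_top by fastforce
  then show ?thesis
    by simp
qed

end

section \<open>Measurability and integration of the lower bound for fixed coins\<close>

locale fixed_policy_instance = search_instance D h + fixed_policy cr cv pol u
  for D :: "real measure" and h :: "real \<Rightarrow> real" and cr cv :: real and pol :: policy
    and u :: "nat \<Rightarrow> bool" +
  assumes measurable_cost: "(\<lambda>w. cost cr cv pol u w) \<in> borel_measurable (cands_M D h)"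
begin

lemma measurable_K [measurable]: "K i \<in> borel_measurable (cands_M D h)"
proof -
  have "solo i \<in> measurable (cands_M D h) (PiM UNIV (\<lambda>_. borel \<Otimes>\<^sub>M count_space UNIV))"
    unfolding solo_def by (rule measurable_PiM_single') (auto simp: space_pair_measure)
  then have "solo i \<in> measurable (cands_M D h) (cands_M D h)"
    using measurable_cong_sets[OF refl sets_cands_M] by blast
  from measurable_compose[OF this measurable_cost] show ?thesis
    by (simp add: K_def[abs_def])
qed

lemma measurable_verif_rank [measurable]: "verif_rank i \<in> borel_measurable (cands_M D h)"
  unfolding verif_rank_def of_bool_def by measurable

lemma measurable_alive [measurable]: "Measurable.pred (cands_M D h) (alive n)"
proof -
  have [measurable]: "Measurable.pred (cands_M D h) (early n j)" for j
  proof -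
    have "(\<lambda>w. ennreal (cr * real n) + ennreal cv * (1 + verif_rank j w)) \<in> borel_measurable (cands_M D h)"
      by (intro borel_measurable_add borel_measurable_times_ennreal borel_measurable_const measurable_verif_rank)
    then have [measurable]: "Measurable.pred (cands_M D h)
        (\<lambda>w. K j w \<le> ennreal (cr * real n) + ennreal cv * (1 + verif_rank j w))"
      unfolding pred_def by (rule borel_measurable_le[OF measurable_K])
    show ?thesis
      unfolding early_def by measurable
  qed
  show ?thesis
    unfolding alive_def by measurable
qed

lemma measurable_reached [measurable]: "Measurable.pred (cands_M D h) (reached n)"
  unfolding reached_def by measurable

text \<open>Pay a prize \<open>lam\<close> for every candidate that is reached and positive; a
  search of finite cost earns at least one. The expected prizes are then charged to generations and
  verifications. Since \<open>ennreal\<close> sends negative reals to 0, the integrand in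
  \<open>opt\<close> is the positive part.\<close>

lemma expected_cost_ge:
  assumes "0 \<le> lam" and opt: "(\<integral>\<^sup>+ r. ennreal (lam * h r - cv) \<partial>D) \<le> ennreal cr"
  shows "ennreal lam \<le> (\<integral>\<^sup>+ w. cost cr cv pol u w \<partial>cands_M D h)"
proof (cases "(\<integral>\<^sup>+ w. cost cr cv pol u w \<partial>cands_M D h) = \<infinity>")
  case False
  let ?P = "cands_M D h"
  have [measurable]: "(\<lambda>w. of_bool (alive n w) :: ennreal) \<in> borel_measurable ?P"
    "(\<lambda>w. of_bool (reached n w) :: ennreal) \<in> borel_measurable ?P"
    "(\<lambda>w. of_bool (snd (w n)) :: ennreal) \<in> borel_measurable ?P" for n
    unfolding of_bool_def by measurable
  have "AE w in ?P. cost cr cv pol u w \<noteq> \<infinity>"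
    using nn_integral_PInf_AE[OF measurable_cost False] .
  moreover have "ennreal lam \<le> (\<Sum>i. of_bool (reached i w) * ennreal lam * of_bool (snd (w i)))"
    if fin: "cost cr cv pol u w \<noteq> \<infinity>" for w
  proof -
    obtain i where i: "reached i w" "snd (w i)"
      using cost_finite_imp_reached[of w] fin by (auto simp: less_top)
    have "(\<Sum>j\<in>{i}. of_bool (reached j w) * ennreal lam * of_bool (snd (w j))) \<le>
        (\<Sum>j. of_bool (reached j w) * ennreal lam * of_bool (snd (w j)))"
      by (rule sum_le_suminf) auto
    with i show ?thesis
      by simp
  qed
  ultimately have "(\<integral>\<^sup>+ w. ennreal lam \<partial>?P) \<le>
      (\<integral>\<^sup>+ w. (\<Sum>i. of_bool (reached i w) * ennreal lam * of_bool (snd (w i))) \<partial>?P)"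
    by (intro nn_integral_mono_AE) auto
  then have "ennreal lam \<le> (\<Sum>i. \<integral>\<^sup>+ w. of_bool (reached i w) * ennreal lam * of_bool (snd (w i) = True) \<partial>?P)"
    by (simp add: nn_integral_suminf cands.emeasure_space_1)
  also have "\<dots> \<le> (\<Sum>i. (\<integral>\<^sup>+ w. of_bool (alive i w) \<partial>?P) * ennreal cr + (\<integral>\<^sup>+ w. of_bool (reached i w) \<partial>?P) * ennreal cv)"
  proof (rule suminf_le)
    fix i
    \<comment> \<open>Only the surplus term is relaxed from \<open>reached\<close> to
      \<open>alive\<close>. Being reached may depend on the score of i, being alive does not, so the
      surplus can afterwards be integrated separately and bounded by \<open>opt\<close>.\<close>
    have le: "of_bool (reached i w) * ennreal lam * ennreal (label_prob True (fst (w i))) \<le>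
        of_bool (alive i w) * ennreal (lam * h (fst (w i)) - cv) + of_bool (reached i w) * ennreal cv" for w
    proof (cases "reached i w")
      case True
      have "ennreal (lam * h (fst (w i))) \<le> ennreal (lam * h (fst (w i)) - cv) + ennreal cv"
        using cv_pos ennreal_leI[of "lam * h (fst (w i))" cv]
        by (cases "lam * h (fst (w i)) \<le> cv") (auto simp: ennreal_plus[symmetric] ennreal_neg simp del: ennreal_plus)
      with True reached_imp_alive[OF True] \<open>0 \<le> lam\<close> show ?thesis
        by (simp add: label_prob_def ennreal_mult')
    qed simp
    have "(\<integral>\<^sup>+ w. of_bool (reached i w) * ennreal lam * of_bool (snd (w i) = True) \<partial>?P) =
        (\<integral>\<^sup>+ w. of_bool (reached i w) * ennreal lam * ennreal (label_prob True (fst (w i))) \<partial>?P)"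
      using reached_upd_label[of i] by (intro nn_integral_cands_label) (auto simp del: fun_upd_apply)
    also have "\<dots> \<le> (\<integral>\<^sup>+ w. of_bool (alive i w) * ennreal (lam * h (fst (w i)) - cv) + of_bool (reached i w) * ennreal cv \<partial>?P)"
      by (intro nn_integral_mono le)
    also have "\<dots> = (\<integral>\<^sup>+ w. of_bool (alive i w) \<partial>?P) * (\<integral>\<^sup>+ r. ennreal (lam * h r - cv) \<partial>D) +
        (\<integral>\<^sup>+ w. of_bool (reached i w) \<partial>?P) * ennreal cv"
      using nn_integral_cands_factor[of "\<lambda>w. of_bool (alive i w)" i "\<lambda>r. ennreal (lam * h r - cv)"]
      by (simp add: nn_integral_add nn_integral_multc alive_upd)
    also have "\<dots> \<le> (\<integral>\<^sup>+ w. of_bool (alive i w) \<partial>?P) * ennreal cr + (\<integral>\<^sup>+ w. of_bool (reached i w) \<partial>?P) * ennreal cv"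
      by (intro add_mono mult_left_mono opt) auto
    finally show "(\<integral>\<^sup>+ w. of_bool (reached i w) * ennreal lam * of_bool (snd (w i) = True) \<partial>?P) \<le> \<dots>" .
  qed auto
  also have "\<dots> = (\<integral>\<^sup>+ w. ennreal cr * (\<Sum>n. of_bool (alive n w)) + ennreal cv * (\<Sum>i. of_bool (reached i w)) \<partial>?P)"
    by (simp add: nn_integral_add nn_integral_cmult nn_integral_suminf suminf_add[symmetric] mult.commute)
  also have "\<dots> \<le> (\<integral>\<^sup>+ w. cost cr cv pol u w \<partial>?P)"
    by (intro nn_integral_mono cost_ge_alive_reached)
  finally show ?thesis .
qed simp

end

lemma (in search_instance) Jstar_ge:
  assumes pos: "0 < cr" "0 < cv" and lam: "0 \<le> lam"
    and opt: "(\<integral>\<^sup>+ r. ennreal (lam * h r - cv) \<partial>D) \<le> ennreal cr"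
  shows "ennreal lam \<le> Jstar cr cv D h"
  unfolding Jstar_def
proof (rule INF_greatest)
  fix pol assume "pol \<in> {pol. admissible cr cv D h pol}"
  then have meas [measurable]: "(\<lambda>x. cost cr cv pol (fst x) (snd x)) \<in> borel_measurable (coins_M \<Otimes>\<^sub>M cands_M D h)"
    by (simp add: admissible_def joint_M_def)
  interpret coins: prob_space coins_M
    unfolding coins_M_def by (intro prob_space_PiM measure_pmf.prob_space_axioms)
  have "ennreal lam \<le> (\<integral>\<^sup>+ w. cost cr cv pol u w \<partial>cands_M D h)" if "u \<in> space coins_M" for u
  proof -
    have "(\<lambda>w. cost cr cv pol u w) \<in> borel_measurable (cands_M D h)"
      using measurable_compose[OF measurable_Pair1'[OF that] meas] by simp
    then interpret fixed_policy_instance D h cr cv pol u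
      by unfold_locales (use pos in auto)
    show ?thesis
      by (rule expected_cost_ge[OF lam opt])
  qed
  then have "(\<integral>\<^sup>+ u. ennreal lam \<partial>coins_M) \<le> (\<integral>\<^sup>+ u. (\<integral>\<^sup>+ w. cost cr cv pol u w \<partial>cands_M D h) \<partial>coins_M)"
    by (intro nn_integral_mono)
  then show "ennreal lam \<le> exp_cost cr cv D h pol"
    by (simp add: exp_cost_def joint_M_def cands.nn_integral_fst[symmetric] coins.emeasure_space_1)
qed

section \<open>Shells and the schedule\<close>

context cost_params
begin

abbreviation cmin :: real where "cmin \<equiv> min cr cv"

lemma cmin_pos: "0 < cmin"
  using cr_pos cv_pos by simp

text \<open>The generation term alone bounds b, as \<open>cmin \<le> cr\<close>. This makes each
  shell finite, so that the maxima in \<open>m_shell\<close> and \<open>k_shell\<close> are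
  attained.\<close>

lemma S_set_le: "(a, b) \<in> S_set cr cv s \<Longrightarrow> a \<le> b \<and> b \<le> s"
proof -
  assume *: "(a, b) \<in> S_set cr cv s"
  then have "cr * 2 ^ b < 2 ^ (s + 1) * cmin"
    using cv_pos by (auto simp: S_set_def intro: order.strict_trans1[rotated])
  also have "\<dots> \<le> cr * 2 ^ (s + 1)"
    by (simp add: mult.commute)
  finally have "(2::real) ^ b < 2 ^ (s + 1)"
    using cr_pos by simp
  then have "b < s + 1"
    using power_less_imp_less_exp one_less_numeral_iff semiring_norm(76) by blast
  with * show ?thesis
    by (auto simp: S_set_def)
qed

lemma finite_S_set: "finite (S_set cr cv s)"
  by (rule finite_subset[of _ "{..s} \<times> {..s}"]) (use S_set_le in force)+

text \<open>With a fixed, raising b by one doubles both summands of the pair's cost.\<close>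

lemma S_set_shift: "(a, b) \<in> S_set cr cv s \<Longrightarrow> (a, b + i) \<in> S_set cr cv (s + i)"
proof -
  assume *: "(a, b) \<in> S_set cr cv s"
  then have "b + i - a = i + (b - a)"
    by (simp add: S_set_def)
  then have eq: "cr * 2 ^ (b + i) + cv * 2 ^ (b + i - a) = 2 ^ i * (cr * 2 ^ b + cv * 2 ^ (b - a))"
    by (simp add: power_add algebra_simps)
  have *: "a \<le> b" "2 ^ s * cmin \<le> cr * 2 ^ b + cv * 2 ^ (b - a)"
      "cr * 2 ^ b + cv * 2 ^ (b - a) < 2 ^ (s + 1) * cmin"
    using * by (auto simp: S_set_def)
  have "2 ^ i * (2 ^ s * cmin) \<le> 2 ^ i * (cr * 2 ^ b + cv * 2 ^ (b - a))"
    by (rule mult_left_mono[OF *(2)]) simp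
  moreover have "2 ^ i * (cr * 2 ^ b + cv * 2 ^ (b - a)) < 2 ^ i * (2 ^ (s + 1) * cmin)"
    by (rule mult_strict_left_mono[OF *(3)]) simp
  moreover have "2 ^ (s + i) * cmin = 2 ^ i * (2 ^ s * cmin)" "2 ^ (s + i + 1) * cmin = 2 ^ i * (2 ^ (s + 1) * cmin)"
    by (simp_all only: power_add mult_ac)
  ultimately show ?thesis
    using *(1) unfolding S_set_def mem_Collect_eq prod.case eq by linarith
qed

lemma S_set_exists:
  assumes "a \<le> b"
  obtains s where "(a, b) \<in> S_set cr cv s"
proof -
  let ?x = "(cr * 2 ^ b + cv * 2 ^ (b - a)) / cmin"
  have "cmin * 1 \<le> cr * 2 ^ b"
    using cr_pos cv_pos by (intro mult_mono) auto
  moreover have "0 \<le> cv * 2 ^ (b - a)"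
    using cv_pos by simp
  ultimately have "cmin * 1 \<le> cr * 2 ^ b + cv * 2 ^ (b - a)"
    by linarith
  then have "1 \<le> ?x"
    using cmin_pos by (simp add: le_divide_eq)
  obtain n where "?x < 2 ^ n"
    using real_arch_pow[of 2 ?x] by auto
  then have "\<exists>n. ?x < 2 ^ n" ..
  then obtain n where n: "?x < 2 ^ n" "\<And>m. m < n \<Longrightarrow> \<not> ?x < 2 ^ m"
    using exists_least_iff[of "\<lambda>n. ?x < 2 ^ n"] by blast
  with \<open>1 \<le> ?x\<close> have "n \<noteq> 0"
    by (intro notI) simp
  then obtain s where s: "n = Suc s"
    using not0_implies_Suc by blast
  with n have "?x < 2 ^ (s + 1)" "2 ^ s \<le> ?x"
    by (auto simp: not_less)
  with assms cmin_pos have "(a, b) \<in> S_set cr cv s"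
    by (auto simp: S_set_def pos_divide_less_eq pos_le_divide_eq)
  with that show thesis .
qed

lemma m_shell_eq: "m_shell cr cv s = 2 ^ (Max (snd ` S_set cr cv s) + 1)"
proof -
  have "(2::real) ^ (Max (snd ` S_set cr cv s) + 1) = real_of_int (2 ^ (Max (snd ` S_set cr cv s) + 1))"
    by simp
  then show ?thesis
    unfolding m_shell_def by (metis ceiling_of_int nat_2 nat_power_eq nat_numeral zero_le_numeral)
qed

lemma k_shell_eq: "k_shell cr cv s = 6 * 2 ^ (Max ((\<lambda>(a, b). b - a) ` S_set cr cv s))"
proof -
  define j where "j = Max ((\<lambda>(a, b). b - a) ` S_set cr cv s)"
  have "6 * (2::real) ^ j = real_of_int (int (6 * 2 ^ j))"
    by simp
  then show ?thesis
    unfolding k_shell_def j_def[symmetric] by (metis ceiling_of_int nat_int)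
qed

lemma m_shell_ge: "(a, b) \<in> S_set cr cv s \<Longrightarrow> 2 ^ (b + 1) \<le> m_shell cr cv s"
  unfolding m_shell_eq
  by (intro power_increasing add_right_mono Max_ge) (auto simp: finite_S_set image_iff intro: bexI[rotated])

lemma k_shell_ge: "(a, b) \<in> S_set cr cv s \<Longrightarrow> 6 * 2 ^ (b - a) \<le> k_shell cr cv s"
  unfolding k_shell_eq
  by (intro mult_left_mono power_increasing Max_ge) (auto simp: finite_S_set image_iff intro: bexI[rotated])

text \<open>An upper bound for the spending in shell s: the truncation of \<open>k_shell\<close> by
  the pool size is dropped. The empty shell is treated apart because \<open>Max\<close> of an empty
  set carries no information.\<close>

definition shell_cost :: "nat \<Rightarrow> real" where
  "shell_cost s = (if S_set cr cv s = {} then 0 else cr * real (m_shell cr cv s) + cv * real (k_shell cr cv s))"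

lemma shell_cost_nonneg: "0 \<le> shell_cost s"
  using cr_pos cv_pos by (simp add: shell_cost_def)

text \<open>The two maxima may come from different pairs, but each pair bounds its own summand by
  \<open>2 * 2 ^ s * cmin\<close>. Generations account for twice this bound, verifications for six
  times it: 4 + 12 = 16.\<close>

lemma shell_cost_le: "shell_cost s \<le> 16 * 2 ^ s * cmin"
proof (cases "S_set cr cv s = {}")
  case False
  have "Max (snd ` S_set cr cv s) \<in> snd ` S_set cr cv s"
    using False finite_S_set by (intro Max_in) auto
  then obtain a b where ab: "(a, b) \<in> S_set cr cv s" "b = Max (snd ` S_set cr cv s)"
    by force
  have "Max ((\<lambda>(a, b). b - a) ` S_set cr cv s) \<in> (\<lambda>(a, b). b - a) ` S_set cr cv s"
    using False finite_S_set by (intro Max_in) auto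
  then obtain a' b' where ab': "(a', b') \<in> S_set cr cv s" "b' - a' = Max ((\<lambda>(a, b). b - a) ` S_set cr cv s)"
    by force
  have "0 \<le> cr * 2 ^ b'" "0 \<le> cv * 2 ^ (b - a)"
    using cr_pos cv_pos by auto
  with ab(1) ab'(1) have "cr * 2 ^ b \<le> 2 * 2 ^ s * cmin" "cv * 2 ^ (b' - a') \<le> 2 * 2 ^ s * cmin"
    by (auto simp: S_set_def)
  then show ?thesis
    using False unfolding shell_cost_def m_shell_eq k_shell_eq ab(2)[symmetric] ab'(2)[symmetric]
    by simp
next
  case True
  then show ?thesis
    using cmin_pos by (simp add: shell_cost_def)
qed

text \<open>Which steps generate and which verify is fixed in advance; the scores decide only whom
  to verify. The counts before shell s are thus plain numbers, and \<open>gens s\<close> is the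
  index of its first fresh candidate.\<close>

definition sched :: "nat \<Rightarrow> bool list" where "sched s = fst (adap_blocks cr cv s)"
definition gens :: "nat \<Rightarrow> nat" where "gens s = fst (snd (adap_blocks cr cv s))"
definition vers :: "nat \<Rightarrow> nat" where "vers s = snd (snd (adap_blocks cr cv s))"
definition shell_vers :: "nat \<Rightarrow> nat" where
  "shell_vers s = min (k_shell cr cv s) (gens s + m_shell cr cv s - vers s)"

abbreviation "start s \<equiv> length (sched s)"

lemma sched_0 [simp]: "sched 0 = []" "gens 0 = 0" "vers 0 = 0"
  by (auto simp: sched_def gens_def vers_def)

lemma sched_Suc_empty:
  assumes "S_set cr cv s = {}"
  shows "sched (Suc s) = sched s" "gens (Suc s) = gens s" "vers (Suc s) = vers s"
  using assms by (auto simp: sched_def gens_def vers_def split: prod.split)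

lemma sched_Suc:
  assumes "S_set cr cv s \<noteq> {}"
  shows "sched (Suc s) = sched s @ replicate (m_shell cr cv s) True @ replicate (shell_vers s) False"
    "gens (Suc s) = gens s + m_shell cr cv s" "vers (Suc s) = vers s + shell_vers s"
  using assms by (auto simp: sched_def gens_def vers_def shell_vers_def Let_def split: prod.split)

lemma start_eq: "start s = gens s + vers s"
proof (induction s)
  case (Suc s)
  then show ?case
    by (cases "S_set cr cv s = {}") (auto simp: sched_Suc_empty sched_Suc)
qed simp

lemma sched_prefix: "s \<le> s' \<Longrightarrow> \<exists>zs. sched s' = sched s @ zs"
proof (induction s' rule: dec_induct)
  case (step n)
  then show ?case
    by (cases "S_set cr cv n = {}") (auto simp: sched_Suc_empty sched_Suc)
qed simp

text \<open>The schedules extend one another, so the least N in \<open>adap_gen_at\<close> may be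
  replaced by any sufficiently large index.\<close>

lemma adap_gen_at_eq:
  assumes "n < start s"
  shows "adap_gen_at cr cv n = sched s ! n"
proof -
  define N where "N = (LEAST N. n < start N)"
  have "n < start N" "N \<le> s"
    unfolding N_def using assms by (rule LeastI, rule Least_le)
  with sched_prefix[of N s] have "sched s ! n = sched N ! n"
    by (auto simp: nth_append)
  then show ?thesis
    by (simp add: adap_gen_at_def Let_def sched_def N_def)
qed

lemma start_mono: "s \<le> s' \<Longrightarrow> start s \<le> start s'"
  using sched_prefix[of s s'] by auto

lemma gen_phase:
  assumes "S_set cr cv s \<noteq> {}" "j < m_shell cr cv s"
  shows "adap_gen_at cr cv (start s + j)"
  using assms by (subst adap_gen_at_eq[of _ "Suc s"]) (auto simp: sched_Suc nth_append)

lemma ver_phase: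
  assumes "S_set cr cv s \<noteq> {}" "j < shell_vers s"
  shows "\<not> adap_gen_at cr cv (start s + m_shell cr cv s + j)"
  using assms by (subst adap_gen_at_eq[of _ "Suc s"]) (auto simp: sched_Suc nth_append)

primrec num_gens :: "nat \<Rightarrow> nat" where
  "num_gens 0 = 0"
| "num_gens (Suc t) = (if adap_gen_at cr cv t then Suc (num_gens t) else num_gens t)"

lemma num_gens_gen_phase:
  assumes "num_gens (start s) = gens s" "S_set cr cv s \<noteq> {}" "j \<le> m_shell cr cv s"
  shows "num_gens (start s + j) = gens s + j"
  using assms(3) by (induction j) (use assms gen_phase in auto)

lemma num_gens_ver_phase:
  assumes "num_gens (start s) = gens s" "S_set cr cv s \<noteq> {}" "j \<le> shell_vers s"
  shows "num_gens (start s + m_shell cr cv s + j) = gens s + m_shell cr cv s"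
  using assms(3) by (induction j) (use assms num_gens_gen_phase ver_phase in auto)

lemma num_gens_start: "num_gens (start s) = gens s"
proof (induction s)
  case (Suc s)
  then show ?case
    using num_gens_ver_phase[of s "shell_vers s"]
    by (cases "S_set cr cv s = {}") (auto simp: sched_Suc_empty sched_Suc add.assoc)
qed simp

lemma gens_ge_nonempty:
  assumes "S_set cr cv s \<noteq> {}"
  shows "gens s < gens (Suc s)"
  using assms by (simp add: sched_Suc m_shell_eq)

lemma start_unbounded: "\<exists>s. n < start s"
proof -
  obtain s0 where s0: "(0, 0) \<in> S_set cr cv s0"
    using S_set_exists[of 0 0] by auto
  have "i \<le> gens (s0 + i)" for i
  proof (induction i)
    case (Suc i)
    from S_set_shift[OF s0, of i] have "S_set cr cv (s0 + i) \<noteq> {}"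
      by auto
    with Suc gens_ge_nonempty show ?case
      by fastforce
  qed simp
  then have "n < start (s0 + Suc n)"
    by (metis start_eq Suc_le_eq trans_le_add1)
  then show ?thesis ..
qed

lemma shell_obtains:
  obtains s where "start s \<le> t" "t < start (Suc s)" "S_set cr cv s \<noteq> {}"
proof -
  obtain s where s: "t < start s" "\<And>s'. s' < s \<Longrightarrow> \<not> t < start s'"
    using start_unbounded[of t] exists_least_iff[of "\<lambda>s. t < start s"] by blast
  then obtain s' where "s = Suc s'"
    by (cases s) auto
  with s that[of s'] sched_Suc_empty[of s'] show thesis
    by (metis lessI not_less)
qed

text \<open>Since t is the number of generations plus that of verifications, this says that the pool
  is non-empty whenever a verification is due, which the truncation in \<open>shell_vers\<close>
  ensures.\<close>

lemma pool_size_pos: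
  assumes "\<not> adap_gen_at cr cv t"
  shows "t < 2 * num_gens t"
proof -
  obtain s where s: "start s \<le> t" "t < start (Suc s)" "S_set cr cv s \<noteq> {}"
    by (rule shell_obtains)
  have "start s + m_shell cr cv s \<le> t"
  proof (rule ccontr)
    assume "\<not> start s + m_shell cr cv s \<le> t"
    then have "t - start s < m_shell cr cv s"
      using s(1) by linarith
    from gen_phase[OF s(3) this] s(1) assms show False
      by simp
  qed
  then obtain j where j: "t = start s + m_shell cr cv s + j"
    using le_Suc_ex by blast
  with s have "j < shell_vers s"
    by (simp add: sched_Suc)
  with j show ?thesis
    using num_gens_ver_phase[OF num_gens_start s(3), of j] by (auto simp: start_eq shell_vers_def less_diff_conv)
qed

end

section \<open>Runs of the shellwise policy\<close>

text \<open>\<open>adap_top\<close> with the history replaced by what it depends on: scores, number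
  of generated candidates and verified candidates. Ties go to the candidate generated first.\<close>

definition top_unverified :: "(nat \<Rightarrow> real) \<Rightarrow> nat \<Rightarrow> nat list \<Rightarrow> nat" where
  "top_unverified r n l =
    (LEAST i. i \<in> {..<n} - set l \<and> (\<forall>j\<in>{..<n} - set l. r j \<le> r i))"

lemma unlisted_nonempty:
  fixes l :: "nat list"
  assumes "length l < n"
  shows "{..<n} - set l \<noteq> {}"
proof
  assume "{..<n} - set l = {}"
  then have "card {..<n} \<le> card (set l)"
    by (intro card_mono) auto
  with assms card_length[of l] show False
    by simp
qed

lemma top_unverified:
  assumes "{..<n} - set l \<noteq> {}"
  shows "top_unverified r n l \<in> {..<n} - set l"
    and "\<forall>j\<in>{..<n} - set l. r j \<le> r (top_unverified r n l)"
proof -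
  have "Max (r ` ({..<n} - set l)) \<in> r ` ({..<n} - set l)"
    using assms by (intro Max_in) auto
  then obtain i where i: "i \<in> {..<n} - set l" "r i = Max (r ` ({..<n} - set l))"
    by (metis imageE)
  then have "i \<in> {..<n} - set l \<and> (\<forall>j\<in>{..<n} - set l. r j \<le> r i)"
    by (auto intro!: Max_ge)
  then have "top_unverified r n l \<in> {..<n} - set l \<and> (\<forall>j\<in>{..<n} - set l. r j \<le> r (top_unverified r n l))"
    unfolding top_unverified_def by (rule LeastI)
  then show "top_unverified r n l \<in> {..<n} - set l"
    and "\<forall>j\<in>{..<n} - set l. r j \<le> r (top_unverified r n l)"
    by auto
qed

lemma top_unverified_cong:
  assumes "\<And>i. i < n \<Longrightarrow> r i = r' i"
  shows "top_unverified r n l = top_unverified r' n l"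
proof -
  have "(i \<in> {..<n} - set l \<and> (\<forall>j\<in>{..<n} - set l. r j \<le> r i)) \<longleftrightarrow>
      (i \<in> {..<n} - set l \<and> (\<forall>j\<in>{..<n} - set l. r' j \<le> r' i))" for i
    using assms by auto
  then show ?thesis
    unfolding top_unverified_def by presburger
qed

context cost_params
begin

text \<open>Verified candidates, latest first, as a function of the scores. The policy never reads a
  label, so this describes the actual run at every time, even past a success. Lists rather than sets
  keep the values in a countable type, which the measurability proofs exploit.\<close>

primrec ver_list :: "(nat \<Rightarrow> real) \<Rightarrow> nat \<Rightarrow> nat list" where
  "ver_list r 0 = []"
| "ver_list r (Suc t) = (if adap_gen_at cr cv t then ver_list r t
     else top_unverified r (num_gens t) (ver_list r t) # ver_list r t)"

lemma ver_list_invariant: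
  "distinct (ver_list r t) \<and> set (ver_list r t) \<subseteq> {..<num_gens t} \<and> length (ver_list r t) + num_gens t = t"
proof (induction t)
  case (Suc t)
  have "{..<num_gens t} - set (ver_list r t) \<noteq> {}" if "\<not> adap_gen_at cr cv t"
    using Suc pool_size_pos[OF that] by (intro unlisted_nonempty) simp
  then show ?case
    using Suc top_unverified(1)[of "num_gens t" "ver_list r t" r] by auto
qed simp

lemma unverified_nonempty:
  assumes "\<not> adap_gen_at cr cv t"
  shows "{..<num_gens t} - set (ver_list r t) \<noteq> {}"
  using ver_list_invariant[of r t] pool_size_pos[OF assms] by (intro unlisted_nonempty) simp

lemma ver_list_cong:
  assumes "\<And>i. i < num_gens t \<Longrightarrow> r i = r' i"
  shows "ver_list r t = ver_list r' t"
  using assms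
proof (induction t)
  case (Suc t)
  then have "ver_list r t = ver_list r' t"
    by (auto split: if_splits)
  moreover have "top_unverified r (num_gens t) l = top_unverified r' (num_gens t) l" for l
    using Suc.prems by (intro top_unverified_cong) (auto split: if_splits)
  ultimately show ?case
    by simp
qed simp

lemma ver_list_mono: "s \<le> t \<Longrightarrow> set (ver_list r s) \<subseteq> set (ver_list r t)"
  by (induction t rule: dec_induct) auto

lemma run_adap:
  fixes u w
  defines "r \<equiv> \<lambda>i. fst (w i)"
  shows "length (run (adap_policy cr cv) u w t) = t \<and>
    gen_scores (run (adap_policy cr cv) u w t) = map r [0..<num_gens t] \<and>
    verified (run (adap_policy cr cv) u w t) = set (ver_list r t) \<and>
    act (adap_policy cr cv) u w t =
      (if adap_gen_at cr cv t then Generate else Verify (top_unverified r (num_gens t) (ver_list r t)))"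
proof -
  have act: "act (adap_policy cr cv) u w t =
      (if adap_gen_at cr cv t then Generate else Verify (top_unverified r (num_gens t) (ver_list r t)))"
    if H: "length H = t" "gen_scores H = map r [0..<num_gens t]" "verified H = set (ver_list r t)"
      "H = run (adap_policy cr cv) u w t" for t H
  proof -
    have pool: "pool H = {..<num_gens t} - set (ver_list r t)"
      using H by (auto simp: pool_def)
    have "(i \<in> pool H \<and> (\<forall>j\<in>pool H. gen_scores H ! j \<le> gen_scores H ! i)) \<longleftrightarrow>
        (i \<in> {..<num_gens t} - set (ver_list r t) \<and> (\<forall>j\<in>{..<num_gens t} - set (ver_list r t). r j \<le> r i))" for i
      using H(2) unfolding pool by auto
    then have "adap_top H = top_unverified r (num_gens t) (ver_list r t)"
      unfolding adap_top_def top_unverified_def by presburger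
    then show ?thesis
      using H by (simp add: act_def adap_policy_def)
  qed
  show ?thesis
  proof (induction t)
    case 0
    show ?case
      using act[of "[]" 0] by simp
  next
    case (Suc t)
    let ?H = "run (adap_policy cr cv) u w (Suc t)"
    have "length ?H = Suc t" "gen_scores ?H = map r [0..<num_gens (Suc t)]" "verified ?H = set (ver_list r (Suc t))"
      using Suc unfolding gen_scores_run_Suc verified_run_Suc by (auto simp: r_def)
    with act[of ?H "Suc t"] show ?case
      by blast
  qed
qed

lemma adap_valid_action: "valid_action (run (adap_policy cr cv) u w t) (act (adap_policy cr cv) u w t)"
  using run_adap[of u w t] top_unverified(1)[OF unverified_nonempty]
  by (auto simp: valid_action_def pool_def)

lemma legal_adap_policy: "legal_policy (adap_policy cr cv)"
  by (simp add: legal_policy_def adap_valid_action)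

lemma adap_no_success_iff:
  "(\<forall>s<t. \<not> success (adap_policy cr cv) u w s) \<longleftrightarrow> (\<forall>i\<in>set (ver_list (\<lambda>i. fst (w i)) t). \<not> snd (w i))"
  (is "?A \<longleftrightarrow> ?B")
proof -
  have "verified (run (adap_policy cr cv) u w t) = set (ver_list (\<lambda>i. fst (w i)) t)"
    using run_adap by blast
  then have "?B \<longleftrightarrow> (\<forall>i\<in>verified (run (adap_policy cr cv) u w t). \<not> snd (w i))"
    by simp
  also have "\<dots> \<longleftrightarrow> ?A"
    unfolding verified_run success_def by (auto split: action.splits)
  finally show ?thesis ..
qed

lemma adap_sum_step_cost_le:
  "(\<Sum>t<start N. step_cost cr cv (act (adap_policy cr cv) u w t)) \<le> (\<Sum>s<N. shell_cost s)"
proof -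
  let ?H = "run (adap_policy cr cv) u w (start N)"
  have "length (gen_scores ?H) = gens N"
    using run_adap[of u w "start N"] num_gens_start by simp
  moreover have "card (verified ?H) = vers N"
    using run_adap[of u w "start N"] num_gens_start[of N] ver_list_invariant[of "\<lambda>i. fst (w i)" "start N"]
    by (simp add: start_eq distinct_card)
  moreover have "cr * real (gens N) + cv * real (vers N) \<le> (\<Sum>s<N. shell_cost s)"
  proof (induction N)
    case (Suc N)
    have "cv * real (shell_vers N) \<le> cv * real (k_shell cr cv N)"
      using cv_pos by (simp add: shell_vers_def)
    with Suc show ?case
      by (cases "S_set cr cv N = {}") (auto simp: sched_Suc sched_Suc_empty shell_cost_def algebra_simps)
  qed simp
  ultimately show ?thesis
    by (subst sum_step_cost) (auto simp: valid_until_def adap_valid_action)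
qed

text \<open>Each shell begun without a previous success is charged in full, including the one in
  which the search ends.\<close>

lemma adap_cost_le:
  "cost cr cv (adap_policy cr cv) u w \<le>
    (\<Sum>s. ennreal (shell_cost s) * of_bool (\<forall>i\<in>set (ver_list (\<lambda>i. fst (w i)) (start s)). \<not> snd (w i)))"
  (is "_ \<le> (\<Sum>s. ?f s)")
proof (cases "\<exists>t. success (adap_policy cr cv) u w t")
  case True
  define T where "T = (LEAST t. success (adap_policy cr cv) u w t)"
  have T: "\<not> success (adap_policy cr cv) u w t" if "t < T" for t
    using that unfolding T_def by (rule not_less_Least)
  have cost: "cost cr cv (adap_policy cr cv) u w = ennreal (\<Sum>s\<le>T. step_cost cr cv (act (adap_policy cr cv) u w s))"
    using True adap_valid_action by (simp add: cost_def T_def Let_def)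
  obtain s where s: "start s \<le> T" "T < start (Suc s)"
    by (rule shell_obtains)
  have "(\<Sum>s\<le>T. step_cost cr cv (act (adap_policy cr cv) u w s)) \<le>
      (\<Sum>t<start (Suc s). step_cost cr cv (act (adap_policy cr cv) u w t))"
    using s cr_pos cv_pos by (intro sum_mono2) (auto simp: step_cost_def split: action.split)
  also have "\<dots> \<le> (\<Sum>s'<Suc s. shell_cost s')"
    by (rule adap_sum_step_cost_le)
  finally have "cost cr cv (adap_policy cr cv) u w \<le> ennreal (\<Sum>s'<Suc s. shell_cost s')"
    unfolding cost by (rule ennreal_leI)
  also have "\<dots> = (\<Sum>s'<Suc s. ennreal (shell_cost s'))"
    by (simp add: shell_cost_nonneg sum_ennreal del: sum.lessThan_Suc)
  also have "\<dots> = (\<Sum>s'<Suc s. ?f s')"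
  proof (rule sum.cong)
    fix s' assume "s' \<in> {..<Suc s}"
    then have "start s' \<le> T"
      using s(1) start_mono[of s' s] by simp
    then have "\<forall>i\<in>set (ver_list (\<lambda>i. fst (w i)) (start s')). \<not> snd (w i)"
      using T adap_no_success_iff[of "start s'" u w] by simp
    then show "ennreal (shell_cost s') = ?f s'"
      by simp
  qed simp
  also have "\<dots> \<le> (\<Sum>s. ?f s)"
    by (rule sum_le_suminf) auto
  finally show ?thesis .
next
  case False
  then have no: "\<forall>i\<in>set (ver_list (\<lambda>i. fst (w i)) (start s)). \<not> snd (w i)" for s
    using adap_no_success_iff by blast
  \<comment> \<open>The cost is infinite here, so the series must diverge: all its indicators are 1,
    and its partial sums dominate the spending on arbitrarily many steps, each costing at least
    \<open>cmin\<close>.\<close>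
  have "of_nat n \<le> (\<Sum>s. ?f s)" for n :: nat
  proof -
    obtain m where m: "real n \<le> cmin * real m"
      using real_arch_simple[of "real n / cmin"] cmin_pos by (auto simp: divide_le_eq mult.commute)
    obtain N where N: "m < start N"
      using start_unbounded by blast
    have "real n \<le> (\<Sum>t<start N. cmin)"
    proof -
      have "cmin * real m \<le> cmin * real (start N)"
        using N cmin_pos by (intro mult_left_mono) simp_all
      with m show ?thesis
        by (simp add: mult.commute)
    qed
    also have "\<dots> \<le> (\<Sum>t<start N. step_cost cr cv (act (adap_policy cr cv) u w t))"
      by (intro sum_mono) (auto simp: step_cost_def split: action.split)
    also have "\<dots> \<le> (\<Sum>s<N. shell_cost s)"
      by (rule adap_sum_step_cost_le)
    finally have "ennreal (real n) \<le> (\<Sum>s<N. ?f s)"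
      unfolding of_bool_def if_P[OF no] using ennreal_leI by (simp add: sum_ennreal shell_cost_nonneg)
    also have "\<dots> \<le> (\<Sum>s. ?f s)"
      by (rule sum_le_suminf) auto
    finally show ?thesis
      by (simp add: ennreal_of_nat_eq_real_of_nat)
  qed
  then have "\<not> (\<Sum>s. ?f s) < \<top>"
    using ennreal_Ex_less_of_nat leD by blast
  then show ?thesis
    by (simp add: less_top[symmetric])
qed

definition shell_verified :: "(nat \<Rightarrow> real) \<Rightarrow> nat \<Rightarrow> nat set" where
  "shell_verified r s = set (ver_list r (start (Suc s))) - set (ver_list r (start s))"

text \<open>P is the pool once the shell has generated its candidates. Removing a best candidate
  repeatedly selects a top segment of P.\<close>

lemma shell_verified_props:
  fixes r
  assumes ne: "S_set cr cv s \<noteq> {}"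
  defines "P \<equiv> {..<gens s + m_shell cr cv s} - set (ver_list r (start s))"
  shows "shell_verified r s \<subseteq> P"
    and "card (shell_verified r s) = min (k_shell cr cv s) (card P)"
    and "\<And>i j. i \<in> shell_verified r s \<Longrightarrow> j \<in> P - shell_verified r s \<Longrightarrow> r j \<le> r i"
proof -
  let ?m = "m_shell cr cv s" and ?V = "set (ver_list r (start s))"
  have V: "?V \<subseteq> {..<gens s}" "card ?V = vers s"
    using ver_list_invariant[of r "start s"] num_gens_start[of s] by (auto simp: start_eq distinct_card)
  have gen: "ver_list r (start s + j) = ver_list r (start s)" if "j \<le> ?m" for j
    using that by (induction j) (use gen_phase[OF ne] in auto)
  \<comment> \<open>Greedy invariant: the removed candidates T dominate the rest of P. The next
    choice is maximal in \<open>P - T\<close>, so adding it preserves the invariant.\<close>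
  have ver: "\<exists>T\<subseteq>P. set (ver_list r (start s + ?m + j)) = ?V \<union> T \<and> card T = j \<and> (\<forall>i\<in>T. \<forall>x\<in>P - T. r x \<le> r i)"
    if "j \<le> shell_vers s" for j
    using that
  proof (induction j)
    case 0
    show ?case
      using gen[of ?m] by (intro exI[of _ "{}"]) auto
  next
    case (Suc j)
    then obtain T where T: "T \<subseteq> P" "set (ver_list r (start s + ?m + j)) = ?V \<union> T" "card T = j"
        "\<forall>i\<in>T. \<forall>x\<in>P - T. r x \<le> r i"
      by auto
    let ?t = "start s + ?m + j"
    have ver: "\<not> adap_gen_at cr cv ?t" and ng: "num_gens ?t = gens s + ?m"
      using ver_phase[OF ne] num_gens_ver_phase[OF num_gens_start ne] Suc.prems by auto
    have eq: "{..<num_gens ?t} - set (ver_list r ?t) = P - T"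
      unfolding T(2) ng P_def by auto
    define i where "i = top_unverified r (num_gens ?t) (ver_list r ?t)"
    have i: "i \<in> P - T" "\<forall>x\<in>P - T. r x \<le> r i"
      using top_unverified[OF unverified_nonempty[OF ver], of r r] unfolding eq i_def by auto
    have "finite T"
      using T(1) by (rule finite_subset) (simp add: P_def)
    then have "card (insert i T) = Suc j"
      using i(1) T(3) by simp
    moreover have "set (ver_list r (start s + ?m + Suc j)) = ?V \<union> insert i T"
      using ver T(2) by (simp add: i_def)
    ultimately show ?case
      using i T(1,4) by (intro exI[of _ "insert i T"]) auto
  qed
  have card_P: "card P = gens s + ?m - vers s"
    unfolding P_def using V by (subst card_Diff_subset) (auto intro: finite_subset)
  obtain T where T: "T \<subseteq> P" "set (ver_list r (start (Suc s))) = ?V \<union> T" "card T = shell_vers s"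
      "\<forall>i\<in>T. \<forall>x\<in>P - T. r x \<le> r i"
    using ver[of "shell_vers s"] by (auto simp: sched_Suc[OF ne] add.assoc)
  then have T_eq: "shell_verified r s = T"
    by (auto simp: shell_verified_def P_def)
  show "shell_verified r s \<subseteq> P" "card (shell_verified r s) = min (k_shell cr cv s) (card P)"
    "\<And>i j. i \<in> shell_verified r s \<Longrightarrow> j \<in> P - shell_verified r s \<Longrightarrow> r j \<le> r i"
    using T unfolding T_eq card_P by (auto simp: shell_vers_def)
qed

end

section \<open>Failure probability of a shell\<close>

text \<open>If at most \<open>k\<close> elements of \<open>J\<close> lie in \<open>A\<close>, those outside \<open>T\<close> can be exchanged injectively for
  elements of \<open>T\<close> with smaller \<open>p\<close>; otherwise the second summand, an exponential Markov bound, is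
  at least 1.\<close>

lemma prod_top_le:
  fixes p :: "'a \<Rightarrow> real"
  assumes "finite P" "T \<subseteq> P" "card T = min k (card P)"
    and order: "\<And>i j. i \<in> T \<Longrightarrow> j \<in> P - T \<Longrightarrow> p i \<le> p j"
    and p: "\<And>i. 0 \<le> p i" "\<And>i. p i \<le> 1"
    and "J \<subseteq> P"
  shows "(\<Prod>i\<in>T. p i) \<le> (\<Prod>i\<in>J. if i \<in> A then p i else 1) + (1/3) ^ k * (\<Prod>i\<in>J. if i \<in> A then 3 else 1)"
proof -
  define JA where "JA = J \<inter> A"
  have fin: "finite J" "finite T" "finite JA"
    using assms by (auto simp: JA_def intro: finite_subset)
  have eq: "(\<Prod>i\<in>J. if i \<in> A then p i else 1) = (\<Prod>i\<in>JA. p i)"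
      "(\<Prod>i\<in>J. if i \<in> A then 3 else (1::real)) = 3 ^ card JA"
    using fin by (simp_all add: JA_def prod.If_cases Int_def)
  have nonneg: "0 \<le> (\<Prod>i\<in>S. p i)" and le1: "(\<Prod>i\<in>S. p i) \<le> 1" for S
    using p by (auto intro: prod_nonneg prod_le_1)
  show ?thesis
  proof (cases "card JA \<le> k")
    case False
    then have "(1/3) ^ k * (3::real) ^ k \<le> (1/3) ^ k * 3 ^ card JA"
      by (intro mult_left_mono power_increasing) auto
    then have "1 \<le> (1/3) ^ k * (3::real) ^ card JA"
      by (simp add: power_mult_distrib[symmetric])
    then show ?thesis
      unfolding eq using nonneg[of JA] le1[of T] by linarith
  next
    case True
    have "(\<Prod>i\<in>T. p i) \<le> (\<Prod>i\<in>JA. p i)"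
    proof (cases "JA \<subseteq> T")
      case True
      then have "(\<Prod>i\<in>T. p i) = (\<Prod>i\<in>JA. p i) * (\<Prod>i\<in>T - JA. p i)"
        using fin by (metis prod.subset_diff mult.commute)
      then show ?thesis
        using nonneg[of JA] le1[of "T - JA"] by (simp add: mult_left_le)
    next
      case False
      \<comment> \<open>If T were all of P it would contain \<open>JA\<close>. So the minimum in
        \<open>card T\<close> is k, which leaves room for an injection of \<open>JA - T\<close> into
        \<open>T - JA\<close>.\<close>
      then have "T \<noteq> P"
        using \<open>J \<subseteq> P\<close> by (auto simp: JA_def)
      then have "card T < card P"
        using assms by (intro psubset_card_mono) auto
      then have "card JA \<le> card T"
        using True assms(3) by simp
      moreover have "card (JA - T) + card (JA \<inter> T) = card JA" "card (T - JA) + card (JA \<inter> T) = card T"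
        using fin by (metis card_Diff_subset_Int card_mono finite_Int inf_le1 le_add_diff_inverse2,
            metis card_Diff_subset_Int card_mono finite_Int inf_le1 le_add_diff_inverse2 inf_commute)
      ultimately have "card (JA - T) \<le> card (T - JA)"
        by linarith
      then obtain f where f: "f ` (JA - T) \<subseteq> T - JA" "inj_on f (JA - T)"
        using card_le_inj[of "JA - T" "T - JA"] fin by auto
      have "(\<Prod>i\<in>T - JA. p i) = (\<Prod>i\<in>f ` (JA - T). p i) * (\<Prod>i\<in>(T - JA) - f ` (JA - T). p i)"
        using fin f by (metis prod.subset_diff mult.commute finite_Diff)
      also have "\<dots> \<le> (\<Prod>i\<in>f ` (JA - T). p i)"
        using nonneg le1 by (simp add: mult_left_le)
      also have "\<dots> = (\<Prod>i\<in>JA - T. p (f i))"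
        using f by (simp add: prod.reindex)
      also have "\<dots> \<le> (\<Prod>i\<in>JA - T. p i)"
        using f(1) p \<open>J \<subseteq> P\<close> by (intro prod_mono conjI order) (auto simp: JA_def)
      finally have "(\<Prod>i\<in>JA \<inter> T. p i) * (\<Prod>i\<in>T - JA. p i) \<le> (\<Prod>i\<in>JA \<inter> T. p i) * (\<Prod>i\<in>JA - T. p i)"
        using nonneg by (intro mult_left_mono)
      moreover have "(\<Prod>i\<in>T. p i) = (\<Prod>i\<in>JA \<inter> T. p i) * (\<Prod>i\<in>T - JA. p i)"
        using prod.Int_Diff[OF fin(2), of p JA] by (simp add: inf_commute)
      moreover have "(\<Prod>i\<in>JA. p i) = (\<Prod>i\<in>JA \<inter> T. p i) * (\<Prod>i\<in>JA - T. p i)"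
        using prod.Int_Diff[OF fin(3), of p T] by simp
      ultimately show ?thesis
        by simp
    qed
    then show ?thesis
      unfolding eq by (simp add: add_increasing2)
  qed
qed

text \<open>With \<open>M = 2 ^ (b + 1)\<close> fresh candidates and \<open>j = b - a\<close>, the
  hypotheses give \<open>M * F \<ge> 2\<close> and \<open>M * q \<le> 2 * 2 ^ j\<close>. As e lies
  between 2 and 3, the first summand is at most 1/4 and the second at most
  \<open>(81 / 729) ^ 2 ^ j\<close>, hence 1/9. The 6 in \<open>k_shell\<close> makes
  \<open>3 ^ 6 = 729\<close> outweigh \<open>3 ^ 4 = 81\<close>.\<close>

lemma shell_failure_le:
  fixes F q :: real
  assumes F: "0 \<le> F" "F \<le> 1" "1 \<le> F * 2 ^ b" and q: "0 \<le> q" "q * 2 ^ a \<le> 1"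
    and "a \<le> b" and k: "6 * 2 ^ (b - a) \<le> k"
  shows "(1 - F) ^ 2 ^ (b + 1) + (1/3) ^ k * (1 + 2 * q) ^ 2 ^ (b + 1) \<le> 3/8"
proof -
  define j where "j = b - a"
  have b: "b = a + j"
    using \<open>a \<le> b\<close> by (simp add: j_def)
  have "1 - F \<le> exp (- F)"
    using exp_ge_add_one_self[of "- F"] by simp
  then have "(1 - F) ^ 2 ^ (b + 1) \<le> exp (- F) ^ 2 ^ (b + 1)"
    using F by (intro power_mono) auto
  also have "\<dots> = exp (- (2 * (F * 2 ^ b)))"
    by (simp add: exp_of_nat_mult[symmetric] mult_ac)
  also have "\<dots> \<le> exp (- 2)"
    using F(3) by simp
  also have "\<dots> = inverse (exp 1 ^ 2)"
    by (simp add: exp_minus exp_of_nat_mult[symmetric])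
  also have "\<dots> \<le> inverse (2 ^ 2)"
    using exp_ge_add_one_self[of 1] by (intro le_imp_inverse_le power_mono) auto
  finally have 1: "(1 - F) ^ 2 ^ (b + 1) \<le> 1/4"
    by simp
  have "q * 2 ^ a * 2 ^ j \<le> 1 * 2 ^ j"
    using q by (intro mult_right_mono) auto
  then have qb: "q * 2 ^ b \<le> 2 ^ j"
    by (simp add: b power_add mult_ac)
  have "(1 + 2 * q) ^ 2 ^ (b + 1) \<le> exp (2 * q) ^ 2 ^ (b + 1)"
    using q exp_ge_add_one_self[of "2 * q"] by (intro power_mono) auto
  also have "\<dots> = exp (4 * (q * 2 ^ b))"
    by (simp add: exp_of_nat_mult[symmetric] mult_ac)
  also have "\<dots> \<le> exp (4 * 2 ^ j)"
    using qb by simp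
  also have "\<dots> = (exp 1 ^ 4) ^ 2 ^ j"
    by (simp add: exp_of_nat_mult[symmetric] mult_ac)
  also have "\<dots> \<le> (3 ^ 4) ^ 2 ^ j"
    using exp_le by (intro power_mono) auto
  finally have "(1 + 2 * q) ^ 2 ^ (b + 1) \<le> 81 ^ 2 ^ j"
    by simp
  moreover have "(1/3 :: real) ^ k \<le> (1/3) ^ (6 * 2 ^ j)"
    using k by (intro power_decreasing) (auto simp: j_def)
  ultimately have "(1/3) ^ k * (1 + 2 * q) ^ 2 ^ (b + 1) \<le> (1/3) ^ (6 * 2 ^ j) * 81 ^ 2 ^ j"
    using q by (intro mult_mono) auto
  also have "\<dots> = ((1/3) ^ 6 * 81) ^ 2 ^ j"
    by (simp only: power_mult power_mult_distrib)
  also have "\<dots> = (1/9) ^ 2 ^ j"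
    by (simp add: power_divide)
  also have "\<dots> \<le> (1/9) ^ 1"
    by (rule power_decreasing) auto
  finally show ?thesis
    using 1 by simp
qed

section \<open>Averaging out the labels\<close>

context search_instance
begin

text \<open>The labels of S are integrated out one by one. The induction varies F because the factor
  gained for one candidate is again a function of scores and is absorbed into F.\<close>

lemma nn_integral_cands_labels:
  assumes "finite S"
    and "F \<in> borel_measurable (cands_M D h)"
    and "\<And>w w'. (\<And>i. fst (w i) = fst (w' i)) \<Longrightarrow> F w = F w'"
  shows "(\<integral>\<^sup>+ w. F w * (\<Prod>i\<in>S. of_bool (snd (w i) = c)) \<partial>cands_M D h) =
    (\<integral>\<^sup>+ w. F w * (\<Prod>i\<in>S. ennreal (label_prob c (fst (w i)))) \<partial>cands_M D h)"
  using assms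
proof (induction S arbitrary: F)
  case empty
  show ?case
    by simp
next
  case (insert i S)
  note F [measurable] = insert.prems(1) and scores = insert.prems(2)
  have [measurable]: "(\<lambda>w. of_bool (snd (w j) = c) :: ennreal) \<in> borel_measurable (cands_M D h)" for j
    unfolding of_bool_def by measurable
  have "(\<integral>\<^sup>+ w. F w * (\<Prod>i\<in>insert i S. of_bool (snd (w i) = c)) \<partial>cands_M D h) =
      (\<integral>\<^sup>+ w. (F w * (\<Prod>j\<in>S. of_bool (snd (w j) = c))) * of_bool (snd (w i) = c) \<partial>cands_M D h)"
    using insert.hyps by (simp add: mult_ac)
  also have "\<dots> = (\<integral>\<^sup>+ w. (F w * (\<Prod>j\<in>S. of_bool (snd (w j) = c))) * ennreal (label_prob c (fst (w i))) \<partial>cands_M D h)"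
  proof (rule nn_integral_cands_label)
    fix w r b b'
    have "F (w(i := (r, b))) = F (w(i := (r, b')))"
      by (rule scores) simp
    moreover have "(\<Prod>j\<in>S. of_bool (snd ((w(i := (r, b))) j) = c) :: ennreal) =
        (\<Prod>j\<in>S. of_bool (snd ((w(i := (r, b'))) j) = c))"
      using insert.hyps by (intro prod.cong) auto
    ultimately show "F (w(i := (r, b))) * (\<Prod>j\<in>S. of_bool (snd ((w(i := (r, b))) j) = c)) =
        F (w(i := (r, b'))) * (\<Prod>j\<in>S. of_bool (snd ((w(i := (r, b'))) j) = c))"
      by simp
  qed measurable
  also have "\<dots> = (\<integral>\<^sup>+ w. (F w * ennreal (label_prob c (fst (w i)))) * (\<Prod>j\<in>S. of_bool (snd (w j) = c)) \<partial>cands_M D h)"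
    by (simp add: mult_ac)
  also have "\<dots> = (\<integral>\<^sup>+ w. (F w * ennreal (label_prob c (fst (w i)))) * (\<Prod>j\<in>S. ennreal (label_prob c (fst (w j)))) \<partial>cands_M D h)"
  proof (rule insert.IH)
    show "F w * ennreal (label_prob c (fst (w i))) = F w' * ennreal (label_prob c (fst (w' i)))"
      if "\<And>i. fst (w i) = fst (w' i)" for w w'
      using scores[OF that] that by simp
  qed measurable
  also have "\<dots> = (\<integral>\<^sup>+ w. F w * (\<Prod>j\<in>insert i S. ennreal (label_prob c (fst (w j)))) \<partial>cands_M D h)"
    using insert.hyps by (simp add: mult_ac)
  finally show ?case .
qed

lemma measurable_top_unverified [measurable]:
  "(\<lambda>w. top_unverified (\<lambda>i. fst (w i)) n l) \<in> measurable (cands_M D h) (count_space UNIV)"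
proof -
  have [measurable]: "Measurable.pred (cands_M D h) (\<lambda>w. fst (w j) \<le> fst (w i))" for i j
    unfolding pred_def by (rule borel_measurable_le[OF measurable_score measurable_score])
  show ?thesis
    unfolding top_unverified_def by (rule measurable_Least) measurable
qed

end

locale search_problem = search_instance D h + cost_params cr cv
  for D :: "real measure" and h :: "real \<Rightarrow> real" and cr cv :: real
begin

lemma measurable_ver_list [measurable]:
  "(\<lambda>w. ver_list (\<lambda>i. fst (w i)) t) \<in> measurable (cands_M D h) (count_space UNIV)"
proof (induction t)
  case (Suc t)
  note [measurable] = Suc
  have "(\<lambda>w. (\<lambda>l w. top_unverified (\<lambda>i. fst (w i)) (num_gens t) l # l) (ver_list (\<lambda>i. fst (w i)) t) w)
      \<in> measurable (cands_M D h) (count_space UNIV)"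
    by (rule measurable_compose_countable[OF _ Suc]) measurable
  then show ?case
    using Suc by simp
qed simp

text \<open>The conditional probability, given all scores, that every verification before time t
  fails.\<close>

definition fail_weight :: "nat \<Rightarrow> (nat \<Rightarrow> real \<times> bool) \<Rightarrow> ennreal" where
  "fail_weight t w = (\<Prod>i\<in>set (ver_list (\<lambda>i. fst (w i)) t). ennreal (1 - h (fst (w i))))"

lemma measurable_fail_weight [measurable]: "fail_weight t \<in> borel_measurable (cands_M D h)"
proof -
  have "(\<lambda>w. (\<lambda>l w. \<Prod>i\<in>set l. ennreal (1 - h (fst (w i)))) (ver_list (\<lambda>i. fst (w i)) t) w)
      \<in> borel_measurable (cands_M D h)"
    by (rule measurable_compose_countable[OF _ measurable_ver_list]) measurable
  then show ?thesis
    by (simp add: fail_weight_def[abs_def])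
qed

lemma fail_weight_le_1: "fail_weight t w \<le> 1"
proof -
  have "fail_weight t w = ennreal (\<Prod>i\<in>set (ver_list (\<lambda>i. fst (w i)) t). 1 - h (fst (w i)))"
    unfolding fail_weight_def by (rule prod_ennreal) simp
  also have "\<dots> \<le> ennreal 1"
    by (intro ennreal_leI prod_le_1) simp
  finally show ?thesis
    by simp
qed

lemma ver_list_bounded: "ver_list r t \<in> {l. set l \<subseteq> {..<t} \<and> length l \<le> t}"
proof -
  have "num_gens t \<le> t"
    using ver_list_invariant[of r t] by linarith
  then show ?thesis
    using ver_list_invariant[of r t] by auto
qed

text \<open>The set of verified candidates is random but determined by the scores. Splitting over
  the finitely many values of \<open>ver_list\<close> reduces to a fixed set, where the labels can
  be averaged out.\<close>

lemma nn_integral_no_success: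
  "(\<integral>\<^sup>+ w. of_bool (\<forall>i\<in>set (ver_list (\<lambda>i. fst (w i)) t). \<not> snd (w i)) \<partial>cands_M D h) =
    (\<integral>\<^sup>+ w. fail_weight t w \<partial>cands_M D h)"
proof -
  let ?L = "{l :: nat list. set l \<subseteq> {..<t} \<and> length l \<le> t}"
  let ?v = "\<lambda>w. ver_list (\<lambda>i. fst (w i)) t"
  have fin: "finite ?L"
    by (rule finite_lists_length_le) simp
  have split: "f (?v w) = (\<Sum>l\<in>?L. of_bool (?v w = l) * f l)" for f :: "nat list \<Rightarrow> ennreal" and w :: "nat \<Rightarrow> real \<times> bool"
  proof -
    have "(\<Sum>l\<in>?L. of_bool (?v w = l) * f l) = (\<Sum>l\<in>{?v w}. of_bool (?v w = l) * f l)"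
      using ver_list_bounded fin by (intro sum.mono_neutral_right) auto
    then show ?thesis
      by simp
  qed
  have [measurable]: "(\<lambda>w. of_bool (?v w = l) :: ennreal) \<in> borel_measurable (cands_M D h)" for l
    unfolding of_bool_def by measurable
  have [measurable]: "(\<lambda>w. of_bool (snd (w j) = False) :: ennreal) \<in> borel_measurable (cands_M D h)" for j
    unfolding of_bool_def by measurable
  have prod: "of_bool (\<forall>i\<in>set l. \<not> snd (w i)) = (\<Prod>i\<in>set l. of_bool (snd (w i) = False) :: ennreal)" for l and w :: "nat \<Rightarrow> real \<times> bool"
    by (induction l) (auto simp: prod.insert_if of_bool_def)
  have "(\<integral>\<^sup>+ w. of_bool (\<forall>i\<in>set (?v w). \<not> snd (w i)) \<partial>cands_M D h) =
      (\<integral>\<^sup>+ w. (\<Sum>l\<in>?L. of_bool (?v w = l) * (\<Prod>i\<in>set l. of_bool (snd (w i) = False))) \<partial>cands_M D h)"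
    unfolding prod by (intro nn_integral_cong) (rule split)
  also have "\<dots> = (\<Sum>l\<in>?L. \<integral>\<^sup>+ w. of_bool (?v w = l) * (\<Prod>i\<in>set l. of_bool (snd (w i) = False)) \<partial>cands_M D h)"
    by (rule nn_integral_sum) measurable
  also have "\<dots> = (\<Sum>l\<in>?L. \<integral>\<^sup>+ w. of_bool (?v w = l) * (\<Prod>i\<in>set l. ennreal (label_prob False (fst (w i)))) \<partial>cands_M D h)"
    by (intro sum.cong refl nn_integral_cands_labels) simp_all
  also have "\<dots> = (\<integral>\<^sup>+ w. (\<Sum>l\<in>?L. of_bool (?v w = l) * (\<Prod>i\<in>set l. ennreal (label_prob False (fst (w i))))) \<partial>cands_M D h)"
    by (rule nn_integral_sum[symmetric]) measurable
  also have "\<dots> = (\<integral>\<^sup>+ w. fail_weight t w \<partial>cands_M D h)"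
    unfolding fail_weight_def label_prob_def by (intro nn_integral_cong, subst split[symmetric]) simp
  finally show ?thesis .
qed

lemma fail_weight_upd:
  assumes "gens s \<le> i"
  shows "fail_weight (start s) (w(i := y)) = fail_weight (start s) w"
proof -
  have eq: "ver_list (\<lambda>j. fst ((w(i := y)) j)) (start s) = ver_list (\<lambda>j. fst (w j)) (start s)"
    using assms num_gens_start[of s] by (intro ver_list_cong) auto
  show ?thesis
    unfolding fail_weight_def eq
    using ver_list_invariant[of "\<lambda>j. fst (w j)" "start s"] num_gens_start[of s] assms
    by (intro prod.cong refl) auto
qed

text \<open>J holds \<open>2 ^ (b + 1)\<close> of the possibly more numerous fresh candidates, so
  that the bound depends on the chosen pair and not on the maxima over the shell. Monotonicity of h
  turns higher scores into smaller factors \<open>1 - h\<close>, as \<open>prod_top_le\<close>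
  requires.\<close>

lemma fail_weight_Suc_le:
  assumes "mono h" and ab: "(a, b) \<in> S_set cr cv s"
  defines "J \<equiv> {gens s..<gens s + 2 ^ (b + 1)}"
  shows "fail_weight (start (Suc s)) w \<le> fail_weight (start s) w *
    ((\<Prod>i\<in>J. ennreal (if fst (w i) \<in> A then 1 - h (fst (w i)) else 1)) +
     ennreal ((1/3) ^ k_shell cr cv s) * (\<Prod>i\<in>J. ennreal (if fst (w i) \<in> A then 3 else 1)))"
proof -
  define r where "r = (\<lambda>i. fst (w i))"
  define V where "V = set (ver_list r (start s))"
  define P where "P = {..<gens s + m_shell cr cv s} - V"
  have ne: "S_set cr cv s \<noteq> {}"
    using ab by auto
  note T = shell_verified_props[OF ne, where r = r, folded V_def, folded P_def]
  have V: "V \<subseteq> {..<gens s}"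
    using ver_list_invariant[of r "start s"] num_gens_start[of s] by (auto simp: V_def)
  have "J \<subseteq> P"
    using V m_shell_ge[OF ab] by (auto simp: J_def P_def)
  then have prod_le: "(\<Prod>i\<in>shell_verified r s. 1 - h (r i)) \<le>
      (\<Prod>i\<in>J. if i \<in> r -` A then 1 - h (r i) else 1) + (1/3) ^ k_shell cr cv s * (\<Prod>i\<in>J. if i \<in> r -` A then 3 else 1)"
    using T monoD[OF \<open>mono h\<close>] by (intro prod_top_le[of P]) (auto simp: P_def)
  have "(\<Prod>i\<in>shell_verified r s. ennreal (1 - h (r i))) = ennreal (\<Prod>i\<in>shell_verified r s. 1 - h (r i))"
    by (rule prod_ennreal) simp
  also have "\<dots> \<le>
      ennreal ((\<Prod>i\<in>J. if i \<in> r -` A then 1 - h (r i) else 1) + (1/3) ^ k_shell cr cv s * (\<Prod>i\<in>J. if i \<in> r -` A then 3 else 1))"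
    by (rule ennreal_leI[OF prod_le])
  also have "\<dots> = ennreal (\<Prod>i\<in>J. if i \<in> r -` A then 1 - h (r i) else 1) +
      ennreal ((1/3) ^ k_shell cr cv s) * ennreal (\<Prod>i\<in>J. if i \<in> r -` A then 3 else 1)"
    by (subst ennreal_plus) (auto intro!: prod_nonneg mult_nonneg_nonneg simp: ennreal_mult')
  also have "\<dots> = (\<Prod>i\<in>J. ennreal (if fst (w i) \<in> A then 1 - h (fst (w i)) else 1)) +
     ennreal ((1/3) ^ k_shell cr cv s) * (\<Prod>i\<in>J. ennreal (if fst (w i) \<in> A then 3 else 1))"
    unfolding r_def vimage_def mem_Collect_eq by (subst (1 2) prod_ennreal) auto
  finally have le: "(\<Prod>i\<in>shell_verified r s. ennreal (1 - h (r i))) \<le> \<dots>" .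
  have "V \<subseteq> set (ver_list r (start (Suc s)))"
    unfolding V_def by (intro ver_list_mono start_mono) simp
  then have "(\<Prod>i\<in>set (ver_list r (start (Suc s))). ennreal (1 - h (r i))) =
      (\<Prod>i\<in>shell_verified r s. ennreal (1 - h (r i))) * (\<Prod>i\<in>V. ennreal (1 - h (r i)))"
    unfolding shell_verified_def V_def by (intro prod.subset_diff) auto
  then have "fail_weight (start (Suc s)) w = fail_weight (start s) w * (\<Prod>i\<in>shell_verified r s. ennreal (1 - h (r i)))"
    by (simp add: fail_weight_def V_def r_def mult.commute)
  also have "\<dots> \<le> fail_weight (start s) w *
    ((\<Prod>i\<in>J. ennreal (if fst (w i) \<in> A then 1 - h (fst (w i)) else 1)) +
     ennreal ((1/3) ^ k_shell cr cv s) * (\<Prod>i\<in>J. ennreal (if fst (w i) \<in> A then 3 else 1)))"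
    by (rule mult_left_mono[OF le]) simp
  finally show ?thesis .
qed

text \<open>By \<open>nn_integral_no_success\<close>, the probability that shell s begins without a
  previous success.\<close>

abbreviation surv :: "nat \<Rightarrow> ennreal" where
  "surv s \<equiv> \<integral>\<^sup>+ w. fail_weight (start s) w \<partial>cands_M D h"

lemma surv_le_1: "surv s \<le> 1"
proof -
  have "surv s \<le> (\<integral>\<^sup>+ w. 1 \<partial>cands_M D h)"
    by (intro nn_integral_mono fail_weight_le_1)
  then show ?thesis
    by (simp add: cands.emeasure_space_1)
qed

text \<open>The past weight ignores the candidates in J, so the products over J integrate
  separately. Their factors have mean \<open>1 - F\<close> and, for 3 raised to the indicator of A,
  mean \<open>1 + 2 * q\<close>.\<close>

lemma surv_Suc_le:
  assumes "mono h" and ab: "(a, b) \<in> S_set cr cv s" and A [measurable]: "A \<in> sets borel"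
    and F: "F = (\<integral>r. indicator A r * h r \<partial>D)" "1 \<le> F * 2 ^ b"
    and q: "q = measure D A" "q * 2 ^ a \<le> 1"
  shows "surv (Suc s) \<le> surv s * ennreal (3/8)"
proof -
  let ?P = "cands_M D h" and ?k = "k_shell cr cv s" and ?M = "2 ^ (b + 1) :: nat"
  define J where "J = {gens s..<gens s + ?M}"
  define g1 where "g1 = (\<lambda>r. ennreal (if r \<in> A then 1 - h r else 1))"
  define g2 where "g2 = (\<lambda>r. ennreal (if r \<in> A then 3 else 1))"
  have [measurable]: "g1 \<in> borel_measurable borel" "g2 \<in> borel_measurable borel"
    unfolding g1_def g2_def by measurable
  have J: "finite J" "card J = ?M" "\<And>i. i \<in> J \<Longrightarrow> gens s \<le> i"
    by (auto simp: J_def)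
  have int: "integrable D (\<lambda>r. indicator A r * h r)" "integrable D (indicator A :: real \<Rightarrow> real)"
    by (auto intro!: D.integrable_const_bound[of _ 1] simp: indicator_def)
  have F01: "0 \<le> F" "F \<le> 1"
  proof -
    show "0 \<le> F"
      unfolding F by (intro integral_nonneg_AE) auto
    have "F \<le> (\<integral>r. 1 \<partial>D)"
      unfolding F using int by (intro integral_mono) (auto simp: indicator_def)
    then show "F \<le> 1"
      by (simp add: D.prob_space)
  qed
  have "(\<integral>\<^sup>+ r. g1 r \<partial>D) = (\<integral>\<^sup>+ r. ennreal (1 - indicator A r * h r) \<partial>D)"
    by (intro nn_integral_cong) (auto simp: g1_def)
  also have "\<dots> = ennreal (\<integral>r. 1 - indicator A r * h r \<partial>D)"
    using int by (intro nn_integral_eq_integral) (auto simp: indicator_def)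
  also have "\<dots> = ennreal (1 - F)"
    using int by (simp add: F D.prob_space)
  finally have g1: "(\<integral>\<^sup>+ r. g1 r \<partial>D) = ennreal (1 - F)" .
  have "(\<integral>\<^sup>+ r. g2 r \<partial>D) = (\<integral>\<^sup>+ r. ennreal (1 + 2 * indicator A r) \<partial>D)"
    by (intro nn_integral_cong) (auto simp: g2_def)
  also have "\<dots> = ennreal (\<integral>r. 1 + 2 * indicator A r \<partial>D)"
    using int by (intro nn_integral_eq_integral Bochner_Integration.integrable_add integrable_mult_right) auto
  also have "\<dots> = ennreal (1 + 2 * q)"
    using int by (simp add: q D.prob_space)
  finally have g2: "(\<integral>\<^sup>+ r. g2 r \<partial>D) = ennreal (1 + 2 * q)" .
  have "0 \<le> q"
    by (simp add: q)
  have "surv (Suc s) \<le> (\<integral>\<^sup>+ w. fail_weight (start s) w * (\<Prod>i\<in>J. g1 (fst (w i))) +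
      ennreal ((1/3) ^ ?k) * (fail_weight (start s) w * (\<Prod>i\<in>J. g2 (fst (w i)))) \<partial>?P)"
    using fail_weight_Suc_le[OF \<open>mono h\<close> ab, of _ A]
    by (intro nn_integral_mono) (simp add: J_def g1_def g2_def algebra_simps)
  also have "\<dots> = (\<integral>\<^sup>+ w. fail_weight (start s) w * (\<Prod>i\<in>J. g1 (fst (w i))) \<partial>?P) +
      ennreal ((1/3) ^ ?k) * (\<integral>\<^sup>+ w. fail_weight (start s) w * (\<Prod>i\<in>J. g2 (fst (w i))) \<partial>?P)"
    by (simp add: nn_integral_add nn_integral_cmult)
  also have "\<dots> = surv s * ennreal (1 - F) ^ ?M + ennreal ((1/3) ^ ?k) * (surv s * ennreal (1 + 2 * q) ^ ?M)"
    using J fail_weight_upd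
    by (subst (1 2) nn_integral_cands_factor_prod) (simp_all add: g1 g2)
  also have "\<dots> = surv s * (ennreal (1 - F) ^ ?M + ennreal ((1/3) ^ ?k) * ennreal (1 + 2 * q) ^ ?M)"
    by (simp only: distrib_left mult_ac)
  also have "ennreal (1 - F) ^ ?M + ennreal ((1/3) ^ ?k) * ennreal (1 + 2 * q) ^ ?M =
      ennreal ((1 - F) ^ ?M) + ennreal ((1/3) ^ ?k) * ennreal ((1 + 2 * q) ^ ?M)"
    using F01 \<open>0 \<le> q\<close> by (subst (1 2) ennreal_power) auto
  also have "\<dots> = ennreal ((1 - F) ^ ?M + (1/3) ^ ?k * (1 + 2 * q) ^ ?M)"
    using F01 \<open>0 \<le> q\<close> by (subst ennreal_plus) (auto simp: ennreal_mult')
  also have "surv s * \<dots> \<le> surv s * ennreal (3/8)"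
  proof -
    have "(1 - F) ^ ?M + (1/3) ^ ?k * (1 + 2 * q) ^ ?M \<le> 3/8"
      using S_set_le[OF ab]
      by (intro shell_failure_le[OF F01 F(2) \<open>0 \<le> q\<close> q(2) _ k_shell_ge[OF ab]]) simp
    then show ?thesis
      by (intro mult_left_mono ennreal_leI) simp_all
  qed
  finally show ?thesis .
qed

end

section \<open>Expected cost of the shellwise policy\<close>

text \<open>a is the largest exponent with \<open>q * 2 ^ a \<le> 1\<close>, b the least with
  \<open>F * 2 ^ b \<ge> 1\<close>.\<close>

lemma dyadic_scales:
  fixes F q :: real
  assumes "0 < F" "F \<le> q" "q \<le> 1"
  obtains a b where "a \<le> b" "1 \<le> F * 2 ^ b" "F * 2 ^ b \<le> 2" "q * 2 ^ a \<le> 1" "1 < q * 2 ^ (a + 1)"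
proof -
  have ex: "\<exists>n. 1 < x * 2 ^ n" if "0 < x" for x :: real
    using real_arch_pow[of 2 "1 / x"] that by (auto simp: divide_less_eq mult.commute)
  obtain n where n: "1 < q * 2 ^ n" "\<And>m. m < n \<Longrightarrow> \<not> 1 < q * 2 ^ m"
    using ex[of q] assms exists_least_iff[of "\<lambda>n. 1 < q * 2 ^ n"] by auto
  then obtain a where a: "n = Suc a"
    using assms by (cases n) auto
  have "\<exists>n. 1 \<le> F * 2 ^ n"
    using ex[of F] assms less_imp_le by blast
  then obtain b where b: "1 \<le> F * 2 ^ b" "\<And>m. m < b \<Longrightarrow> \<not> 1 \<le> F * 2 ^ m"
    using exists_least_iff[of "\<lambda>n. 1 \<le> F * 2 ^ n"] by auto
  \<comment> \<open>Minimality of b, except for b = 0, where \<open>F \<le> q \<le> 1\<close> is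
    used.\<close>
  have "F * 2 ^ b \<le> 2"
    using b(2)[of "b - 1"] assms by (cases b) auto
  have qa: "q * 2 ^ a \<le> 1"
    using n(2)[of a] a by simp
  \<comment> \<open>If a exceeded b, then
    \<open>F * 2 ^ b \<le> q * 2 ^ b \<le> 1/2\<close>.\<close>
  have "a \<le> b"
  proof (rule ccontr)
    assume "\<not> a \<le> b"
    then have "q * 2 ^ Suc b \<le> q * 2 ^ a"
      using assms by (intro mult_left_mono power_increasing) auto
    moreover have "F * 2 ^ b \<le> q * 2 ^ b"
      using assms by (intro mult_right_mono) auto
    ultimately show False
      using qa b(1) by simp
  qed
  with b(1) \<open>F * 2 ^ b \<le> 2\<close> qa n(1) a that show thesis
    by simp
qed

context search_problem
begin

lemma exp_cost_adap_le:
  "exp_cost cr cv D h (adap_policy cr cv) \<le> (\<Sum>s. ennreal (shell_cost s) * surv s)"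
proof -
  let ?f = "\<lambda>s w. of_bool (\<forall>i\<in>set (ver_list (\<lambda>i. fst (w i)) (start s)). \<not> snd (w i)) :: ennreal"
  interpret coins: prob_space coins_M
    unfolding coins_M_def by (intro prob_space_PiM measure_pmf.prob_space_axioms)
  have [measurable]: "?f s \<in> borel_measurable (cands_M D h)" for s
  proof -
    have "(\<lambda>w. (\<lambda>l w. of_bool (\<forall>i\<in>set l. \<not> snd (w i)) :: ennreal) (ver_list (\<lambda>i. fst (w i)) (start s)) w)
        \<in> borel_measurable (cands_M D h)"
      unfolding of_bool_def by (rule measurable_compose_countable[OF _ measurable_ver_list]) measurable
    then show ?thesis
      by simp
  qed
  have "exp_cost cr cv D h (adap_policy cr cv) \<le>
      (\<integral>\<^sup>+ x. (\<Sum>s. ennreal (shell_cost s) * ?f s (snd x)) \<partial>(coins_M \<Otimes>\<^sub>M cands_M D h))"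
    unfolding exp_cost_def joint_M_def by (intro nn_integral_mono adap_cost_le)
  also have "\<dots> = (\<integral>\<^sup>+ u. (\<integral>\<^sup>+ w. (\<Sum>s. ennreal (shell_cost s) * ?f s w) \<partial>cands_M D h) \<partial>coins_M)"
    by (subst cands.nn_integral_fst[symmetric]) simp_all
  also have "\<dots> = (\<integral>\<^sup>+ w. (\<Sum>s. ennreal (shell_cost s) * ?f s w) \<partial>cands_M D h)"
    by (simp add: coins.emeasure_space_1)
  also have "\<dots> = (\<Sum>s. ennreal (shell_cost s) * (\<integral>\<^sup>+ w. ?f s w \<partial>cands_M D h))"
    by (simp add: nn_integral_suminf nn_integral_cmult)
  also have "\<dots> = (\<Sum>s. ennreal (shell_cost s) * surv s)"
    by (simp only: nn_integral_no_success)
  finally show ?thesis .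
qed

text \<open>The trivial bound 1 on survival serves before \<open>s0\<close>, where the costs double
  up to \<open>16 * 2 ^ s0 * cmin\<close>. From \<open>s0\<close> on the terms shrink by
  \<open>2 * 3/8 = 3/4\<close>, which adds four times this amount.\<close>

lemma exp_cost_adap_le_shell:
  assumes surv: "\<And>i. surv (s0 + i) \<le> ennreal ((3/8) ^ i)"
  shows "exp_cost cr cv D h (adap_policy cr cv) \<le> ennreal (80 * 2 ^ s0 * cmin)"
proof -
  define g where "g s = 16 * 2 ^ s * cmin * (if s < s0 then 1 else (3/8) ^ (s - s0))" for s
  have g: "0 \<le> g s" for s
    using cmin_pos by (simp add: g_def)
  have le: "ennreal (shell_cost s) * surv s \<le> ennreal (g s)" for s
  proof -
    have "surv s \<le> ennreal (if s < s0 then 1 else (3/8) ^ (s - s0))"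
      using surv[of "s - s0"] surv_le_1[of s] by (cases "s < s0") auto
    then have "ennreal (shell_cost s) * surv s \<le>
        ennreal (16 * 2 ^ s * cmin) * ennreal (if s < s0 then 1 else (3/8) ^ (s - s0))"
      by (intro mult_mono ennreal_leI shell_cost_le) auto
    also have "\<dots> = ennreal (g s)"
      using cmin_pos by (simp add: g_def ennreal_mult'[symmetric])
    finally show ?thesis .
  qed
  have before: "(\<Sum>s<n. g s) = 16 * cmin * (2 ^ n - 1)" if "n \<le> s0" for n
    using that by (induction n) (auto simp: g_def algebra_simps)
  have after: "(\<Sum>s<s0 + i. g s) = 16 * cmin * (2 ^ s0 - 1) + 64 * cmin * 2 ^ s0 * (1 - (3/4) ^ i)" for i
  proof (induction i)
    case (Suc i)
    have "g (s0 + i) = 16 * cmin * 2 ^ s0 * (2 ^ i * (3/8) ^ i)"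
      by (simp add: g_def power_add)
    also have "(2::real) ^ i * (3/8) ^ i = (3/4) ^ i"
      by (simp flip: power_mult_distrib)
    finally show ?case
      using Suc by (simp add: algebra_simps)
  qed (simp add: before)
  have bound: "(\<Sum>s<n. g s) \<le> 80 * 2 ^ s0 * cmin" for n
  proof -
    have "(\<Sum>s<n. g s) \<le> (\<Sum>s<s0 + n. g s)"
      using g by (intro sum_mono2) auto
    also have "\<dots> = 80 * 2 ^ s0 * cmin - (16 * cmin + 64 * cmin * 2 ^ s0 * (3/4) ^ n)"
      unfolding after by (simp add: algebra_simps)
    also have "\<dots> \<le> 80 * 2 ^ s0 * cmin"
    proof -
      have "0 \<le> 16 * cmin + 64 * cmin * 2 ^ s0 * (3/4) ^ n"
        using cmin_pos by (intro add_nonneg_nonneg mult_nonneg_nonneg) auto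
      then show ?thesis
        by linarith
    qed
    finally show ?thesis .
  qed
  have "(\<Sum>s. ennreal (shell_cost s) * surv s) \<le> (\<Sum>s. ennreal (g s))"
    by (intro suminf_le le) auto
  also have "\<dots> = (SUP n. \<Sum>s<n. ennreal (g s))"
    by (rule suminf_eq_SUP)
  also have "\<dots> \<le> ennreal (80 * 2 ^ s0 * cmin)"
    using g bound by (intro SUP_least) (simp add: ennreal_leI)
  finally show ?thesis
    using exp_cost_adap_le by (rule order_trans[rotated])
qed

text \<open>Intermediate value theorem for \<open>phi\<close>, which is 1-Lipschitz because h takes
  values in [0,1], and vanishes at 0. At \<open>(cr + cv) / mu\<close> it is at least
  \<open>cr\<close>: omitting the positive part leaves \<open>(cr + cv) - cv\<close>. A positive
  success probability is what makes \<open>mu\<close> positive.\<close>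

lemma threshold_exists:
  assumes pos: "0 < measure (cand_measure D h) {x. snd x}"
  obtains lam where "0 < lam" "(\<integral>\<^sup>+ r. ennreal (lam * h r - cv) \<partial>D) = ennreal cr"
    "lam * (\<integral>r. indicator {r. cv < lam * h r} r * h r \<partial>D) = cr + cv * measure D {r. cv < lam * h r}"
proof -
  have int_h: "integrable D h"
    by (rule D.integrable_const_bound[of _ 1]) auto
  define mu where "mu = (\<integral>r. h r \<partial>D)"
  have "emeasure (cand_measure D h) {x. snd x} = ennreal mu"
    unfolding emeasure_cand_measure_snd mu_def using int_h by (intro nn_integral_eq_integral) auto
  with pos have mu: "0 < mu"
    by (auto simp: measure_def enn2real_positive_iff)
  define phi where "phi x = (\<integral>r. max 0 (x * h r - cv) \<partial>D)" for x
  have int: "integrable D (\<lambda>r. max 0 (x * h r - cv))" for x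
    using int_h by (intro integrable_max) auto
  have lip: "phi x - phi y \<le> \<bar>x - y\<bar>" for x y
  proof -
    have "phi x - phi y = (\<integral>r. max 0 (x * h r - cv) - max 0 (y * h r - cv) \<partial>D)"
      unfolding phi_def using int by simp
    also have "\<dots> \<le> (\<integral>r. \<bar>x - y\<bar> \<partial>D)"
    proof (rule integral_mono)
      fix r
      have "\<bar>x * h r - y * h r\<bar> \<le> \<bar>x - y\<bar> * 1"
        unfolding left_diff_distrib[symmetric] abs_mult by (intro mult_left_mono) auto
      then show "max 0 (x * h r - cv) - max 0 (y * h r - cv) \<le> \<bar>x - y\<bar>"
        by (auto simp: max_def abs_le_iff)
    qed (use int in auto)
    finally show ?thesis
      by (simp add: D.prob_space)
  qed
  have "1-lipschitz_on UNIV phi"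
  proof (rule lipschitz_onI)
    show "dist (phi x) (phi y) \<le> 1 * dist x y" for x y
      using lip[of x y] lip[of y x] by (auto simp: dist_real_def abs_le_iff abs_minus_commute)
  qed simp
  then have cont: "continuous_on {0..(cr + cv) / mu} phi"
    using lipschitz_on_continuous_on continuous_on_subset by blast
  have "phi 0 = 0"
    using cv_pos by (simp add: phi_def)
  moreover have "cr \<le> phi ((cr + cv) / mu)"
  proof -
    have "(\<integral>r. (cr + cv) / mu * h r - cv \<partial>D) \<le> phi ((cr + cv) / mu)"
      unfolding phi_def using int int_h by (intro integral_mono) auto
    then show ?thesis
      using int_h mu by (simp add: D.prob_space mu_def[symmetric])
  qed
  ultimately obtain lam where lam: "0 \<le> lam" "phi lam = cr"
    using IVT'[of phi 0 cr "(cr + cv) / mu"] cont cr_pos cv_pos mu by auto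
  have "lam \<noteq> 0"
    using lam \<open>phi 0 = 0\<close> cr_pos by auto
  have "(\<integral>\<^sup>+ r. ennreal (lam * h r - cv) \<partial>D) = (\<integral>\<^sup>+ r. ennreal (max 0 (lam * h r - cv)) \<partial>D)"
    by (intro nn_integral_cong) (simp add: max_def ennreal_neg)
  also have "\<dots> = ennreal cr"
    unfolding lam(2)[symmetric] phi_def using int by (intro nn_integral_eq_integral) auto
  finally have 1: "(\<integral>\<^sup>+ r. ennreal (lam * h r - cv) \<partial>D) = ennreal cr" .
  let ?A = "{r. cv < lam * h r}"
  have [measurable]: "?A \<in> sets borel"
    by measurable
  have intA: "integrable D (\<lambda>r. indicator ?A r * h r)" "integrable D (indicator ?A :: real \<Rightarrow> real)"
    by (auto intro!: D.integrable_const_bound[of _ 1] simp: indicator_def)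
  have "cr = (\<integral>r. lam * (indicator ?A r * h r) - cv * indicator ?A r \<partial>D)"
    unfolding lam(2)[symmetric] phi_def by (intro Bochner_Integration.integral_cong) (auto simp: indicator_def)
  also have "\<dots> = lam * (\<integral>r. indicator ?A r * h r \<partial>D) - cv * measure D ?A"
    using intA by (simp add: space_D)
  finally have "lam * (\<integral>r. indicator ?A r * h r \<partial>D) = cr + cv * measure D ?A"
    by simp
  moreover have "0 < lam"
    using lam(1) \<open>lam \<noteq> 0\<close> by simp
  ultimately show thesis
    using that[OF _ 1] by blast
qed

lemma adap_competitive:
  assumes "0 < measure (cand_measure D h) {x. snd x}" and "mono h"
  shows "exp_cost cr cv D h (adap_policy cr cv) \<le> 400 * Jstar cr cv D h"
proof -
  obtain lam where lam: "0 < lam" "(\<integral>\<^sup>+ r. ennreal (lam * h r - cv) \<partial>D) = ennreal cr"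
    "lam * (\<integral>r. indicator {r. cv < lam * h r} r * h r \<partial>D) = cr + cv * measure D {r. cv < lam * h r}"
    using threshold_exists[OF assms(1)] by blast
  define A where "A = {r. cv < lam * h r}"
  define F where "F = (\<integral>r. indicator A r * h r \<partial>D)"
  define q where "q = measure D A"
  have A [measurable]: "A \<in> sets borel"
    unfolding A_def by measurable
  have opt: "lam * F = cr + cv * q"
    using lam(3) by (simp add: A_def F_def q_def)
  have q: "0 \<le> q" "q \<le> 1"
    by (auto simp: q_def)
  have "0 < lam * F"
    unfolding opt using cr_pos cv_pos q by (intro add_pos_nonneg) auto
  then have "0 < F"
    using lam(1) by (simp add: zero_less_mult_iff)
  have "F \<le> (\<integral>r. indicator A r \<partial>D)"
    unfolding F_def by (intro integral_mono)
      (auto intro!: D.integrable_const_bound[of _ 1] simp: indicator_def)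
  then have "F \<le> q"
    by (simp add: q_def space_D)
  obtain a b where ab: "a \<le> b" "1 \<le> F * 2 ^ b" "F * 2 ^ b \<le> 2" "q * 2 ^ a \<le> 1" "1 < q * 2 ^ (a + 1)"
    by (rule dyadic_scales[OF \<open>0 < F\<close> \<open>F \<le> q\<close> q(2)])
  obtain s0 where s0: "(a, b) \<in> S_set cr cv s0"
    by (rule S_set_exists[OF ab(1)])
  have "surv (s0 + i) \<le> ennreal ((3/8) ^ i)" for i
  proof (induction i)
    case 0
    show ?case
      using surv_le_1 by simp
  next
    case (Suc i)
    \<comment> \<open>Only b grows along the shells: the condition on F improves, the one on q
      involves a alone.\<close>
    have "F * 2 ^ b \<le> F * 2 ^ (b + i)"
      using \<open>0 < F\<close> by (intro mult_left_mono power_increasing) auto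
    then have "surv (Suc (s0 + i)) \<le> surv (s0 + i) * ennreal (3/8)"
      using ab by (intro surv_Suc_le[OF \<open>mono h\<close> S_set_shift[OF s0, of i] A F_def _ q_def]) auto
    also have "\<dots> \<le> ennreal ((3/8) ^ i) * ennreal (3/8)"
      by (intro mult_right_mono Suc) simp
    also have "\<dots> = ennreal ((3/8) ^ Suc i)"
      by (simp add: ennreal_mult'[symmetric] mult.commute)
    finally show ?case
      by simp
  qed
  then have "exp_cost cr cv D h (adap_policy cr cv) \<le> ennreal (80 * 2 ^ s0 * cmin)"
    by (rule exp_cost_adap_le_shell)
  also have "\<dots> \<le> ennreal (400 * lam)"
  proof (rule ennreal_leI)
    \<comment> \<open>From \<open>F * 2 ^ b \<le> 2\<close> and \<open>1 < q * 2 ^ (a + 1)\<close>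
      follows \<open>F * 2 ^ (b - a) \<le> 4 * q\<close>. So F times the cost of the pair is at most
      \<open>4 * (cr + cv * q)\<close>, which \<open>opt\<close> identifies as
      \<open>4 * lam * F\<close>.\<close>
    have "2 ^ (b - a) * (2::real) ^ a = 2 ^ b"
      using ab(1) by (simp add: power_add[symmetric])
    then have "F * 2 ^ (b - a) * 2 ^ a \<le> 2"
      using ab(3) by (simp add: mult.assoc)
    also have "\<dots> \<le> 2 * (q * 2 ^ (a + 1))"
      using ab(5) by simp
    also have "\<dots> = (4 * q) * 2 ^ a"
      by simp
    finally have "F * 2 ^ (b - a) \<le> 4 * q"
      by (rule mult_right_le_imp_le) simp
    then have "cr * (F * 2 ^ b) + cv * (F * 2 ^ (b - a)) \<le> cr * 4 + cv * (4 * q)"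
      using ab(3) cr_pos cv_pos by (intro add_mono mult_left_mono) auto
    then have "F * (cr * 2 ^ b + cv * 2 ^ (b - a)) \<le> F * (4 * lam)"
      using opt by (simp add: algebra_simps)
    then have "cr * 2 ^ b + cv * 2 ^ (b - a) \<le> 4 * lam"
      using \<open>0 < F\<close> by simp
    moreover have "2 ^ s0 * cmin \<le> cr * 2 ^ b + cv * 2 ^ (b - a)"
      using s0 by (simp add: S_set_def)
    ultimately show "80 * 2 ^ s0 * cmin \<le> 400 * lam"
      using lam(1) unfolding mult.assoc by linarith
  qed
  also have "\<dots> = 400 * ennreal lam"
    using lam(1) by (simp add: ennreal_mult')
  also have "\<dots> \<le> 400 * Jstar cr cv D h"
    using lam by (intro mult_left_mono Jstar_ge cr_pos cv_pos) auto
  finally show ?thesis .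
qed

end

theorem theorem2:
  fixes D :: "real measure" and h :: "real \<Rightarrow> real" and cr cv :: real
  assumes "cr > 0" and "cv > 0"
    and "prob_space D" and "sets D = sets borel"
    and "h \<in> borel_measurable borel" and "\<forall>r. 0 \<le> h r \<and> h r \<le> 1"
    and "measure (cand_measure D h) {x. snd x} > 0"
    and "mono h"
  shows "legal_policy (adap_policy cr cv) \<and>
         exp_cost cr cv D h (adap_policy cr cv) \<le> 400 * Jstar cr cv D h"
proof -
  interpret search_problem D h cr cv
    using assms by (intro search_problem.intro search_instance.intro cost_params.intro) auto
  show ?thesis
    using legal_adap_policy adap_competitive[OF assms(7,8)] by blast
qed

end
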